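(* Let $\Omega,U,H,L,\mathcal{M}_0$ be as in the context, under assumptions (H1), (H2), (H3), (H4) and (A1) listed there, and let $u^\gamma\in C(\overline\Omega)$, $\gamma\in\mathbb{R}$, be the functions defined there. The mapping $\gamma\mapsto u^\gamma(\cdot)$ from $\mathbb{R}$ to $C(\overline\Omega)$ is concave and decreasing. Precisely, if $\alpha,\beta\in\mathbb{R}$ with $\alpha\le\beta$, then $u^\beta\le u^\alpha$ and $$(1-\lambda)u^\alpha+\lambda u^\beta\le u^{(1-\lambda)\alpha+\lambda\beta}\qquad\text{for every }\lambda\in[0,1].$$
   Context: $\Omega\subset\mathbb{R}^n$ is open, bounded, connected, with $0\in\Omega$. $U=B(0,R_0)$ is an open ball with $2\Omega\subseteq U$, and $H:\overline U\times\mathbb{R}^n\to\mathbb{R}$ is continuous. The Lagrangian is $L(x,v)=\sup_{p\in\mathbb{R}^n}(p\cdot v-H(x,p))$, $(x,v)\in\overline U\times\mathbb{R}^n$. Assumptions: (H1) for each $R>0$ there is $C_R$ with $|H(x,p)-H(y,p)|\le C_R|x-y|$ and $|H(x,p)-H(x,q)|\le C_R|p-q|$ for $x,y\in\overline U$, $|p|,|q|\le R$; (H2) $\lim_{|p|\to\infty}\min_{x\in\overline U}H(x,p)=+\infty$; (H3) $p\mapsto H(x,p)$ is convex for each $x\in\overline U$; (H4) for $v\in\mathbb{R}^n$, $x\mapsto L(x,v)$ is continuously differentiable on $\overline U$; (A1) $\Omega$ is star-shaped with respect to the origin and there is $\kappa>0$ such that $\mathrm{dist}(x,\overline\Omega)\ge\kappa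 s$ for all $s>0$ and $x\in(1+s)\partial\Omega$. $c(0)=\inf\{c\in\mathbb{R}:H(x,Dv)\le c\text{ has a viscosity subsolution in }\Omega\}$ is the additive eigenvalue of $H$ in $\Omega$. Normalization (made without loss of generality; not an additional restriction on $H$): the solutions considered satisfy an a priori gradient bound $|Du|\le C_H$ with $C_H$ depending only on $H$, so the values of $H(x,p)$ for large $|p|$ are irrelevant; after modifying $H$ for large $|p|$ one may assume that there is $h>0$ such that $H(x,p)=\sup_{|v|\le h}(p\cdot v-L(x,v))$ for $(x,p)\in\overline\Omega\times\mathbb{R}^n$ and $L(x,v)=\sup_{p}(p\cdot v-H(x,p))$ for $(x,v)\in\overline\Omega\times\overline B_h$, with $L\in C(\overline\Omega\times\overline B_h)$, where $\overline B_h$ is the closed ball of radius $h$ at $0$ in $\mathbb{R}^n$. The measures below are defined with this normalization. Viscosity Mather measures: for $f\in C(\overline\Omega\times\overline B_h)$ put $H_f(x,p)=\max_{|v|\le h}(p\cdot v-f(x,v))$. Let $\mathcal{G}_{0,\Omega}$ be the set of $f\in C(\overline\Omega\times\overline B_h)$ for which there is $u\in C(\overline\Omega)$ that is a viscosity subsolution of $H_f(x,Du)\le0$ in $\Omega$. For a Radon measure $\mu$ on $\overline\Omega\times\overline B_h$ write $\langle\mu,f\rangle=\int f\,d\mu$ (functions of $x$ alone are viewed as functions of $(x,v)$), and let $\mathcal{G}'_{0,\Omega}$ be the set of Radon measures with $\langle\mu,f\rangle\ge0$ for all $f\in\mathcal{G}_{0,\Omega}$. $\mathcal{M}_0$ is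 the set of probability measures $\mu\in\mathcal{G}'_{0,\Omega}$ with $\langle\mu,L\rangle=-c(0)$ (this is the minimum of $\langle\mu,L\rangle$ over probability measures in $\mathcal{G}'_{0,\Omega}$). For $\gamma\in\mathbb{R}$, $\mathcal{E}^\gamma$ is the family of viscosity subsolutions $w\in C(\overline\Omega)$ of $H(x,Dw)\le c(0)$ in $\Omega$ with $\gamma\langle\mu,(-x)\cdot D_xL(x,v)\rangle+\langle\mu,w\rangle\le0$ for all $\mu\in\mathcal{M}_0$, and $u^\gamma=\sup_{w\in\mathcal{E}^\gamma}w$. It is also the locally uniform limit in $\Omega$ as $\lambda\to0^+$ of $u_\lambda+c(0)/\phi(\lambda)$, where $u_\lambda$ is the state-constraint viscosity solution of $\phi(\lambda)u_\lambda+H(x,Du_\lambda)=0$ in $(1+r(\lambda))\Omega$ (subsolution in the open set, supersolution on its closure), whenever $\phi>0$ is continuous nondecreasing, $r$ is continuous, $\phi,r\to0$ and $r(\lambda)/\phi(\lambda)\to\gamma$ as $\lambda\to0^+$. *)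

theory Defs
  imports "HOL-Analysis.Analysis" "HOL-Probability.Probability"
begin

definition has_C1_gradient_on :: "('a::euclidean_space \<Rightarrow> real) \<Rightarrow> ('a \<Rightarrow> 'a) \<Rightarrow> 'a set \<Rightarrow> bool" where
  "has_C1_gradient_on f D S \<longleftrightarrow>
     continuous_on S D \<and> (\<forall>x\<in>S. (f has_derivative (\<lambda>y. y \<bullet> D x)) (at x within S))"

definition lagrangian :: "('a::euclidean_space \<Rightarrow> 'a \<Rightarrow> real) \<Rightarrow> 'a \<Rightarrow> 'a \<Rightarrow> real" where
  "lagrangian H x v = (SUP p. p \<bullet> v - H x p)"

text \<open>Only used at points \<open>x\<close> of \<open>closure \<Omega>\<close>, which lies in the open ball \<open>U\<close>; so the
  two-sided gradient is meant there.\<close>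

definition lagrangian_Dx :: "('a::euclidean_space \<Rightarrow> 'a \<Rightarrow> real) \<Rightarrow> 'a \<Rightarrow> 'a \<Rightarrow> 'a" where
  "lagrangian_Dx H x v = (THE d. GDERIV (\<lambda>y. lagrangian H y v) x :> d)"

definition H1 :: "('a::euclidean_space \<Rightarrow> 'a \<Rightarrow> real) \<Rightarrow> 'a set \<Rightarrow> bool" where
  "H1 H K \<longleftrightarrow> (\<forall>R>0. \<exists>C. \<forall>x\<in>K. \<forall>y\<in>K. \<forall>p q. norm p \<le> R \<longrightarrow> norm q \<le> R \<longrightarrow>
     \<bar>H x p - H y p\<bar> \<le> C * norm (x - y) \<and> \<bar>H x p - H x q\<bar> \<le> C * norm (p - q))"

definition H2 :: "('a::euclidean_space \<Rightarrow> 'a \<Rightarrow> real) \<Rightarrow> 'a set \<Rightarrow> bool" where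
  "H2 H K \<longleftrightarrow> filterlim (\<lambda>p. INF x\<in>K. H x p) at_top at_infinity"

definition H3 :: "('a::euclidean_space \<Rightarrow> 'a \<Rightarrow> real) \<Rightarrow> 'a set \<Rightarrow> bool" where
  "H3 H K \<longleftrightarrow> (\<forall>x\<in>K. convex_on UNIV (H x))"

text \<open>Continuous differentiability of \<open>L(\<cdot>, v)\<close> presupposes that \<open>L(\<cdot>, v)\<close> is real-valued. Since
  \<open>SUP\<close> on the reals has an arbitrary value for unbounded sets, the finiteness of the supremum
  has to be spelled out.\<close>

definition H4 :: "('a::euclidean_space \<Rightarrow> 'a \<Rightarrow> real) \<Rightarrow> 'a set \<Rightarrow> bool" where
  "H4 H K \<longleftrightarrow> (\<forall>v. (\<forall>x\<in>K. bdd_above (range (\<lambda>p. p \<bullet> v - H x p))) \<and>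
     (\<exists>D. has_C1_gradient_on (\<lambda>x. lagrangian H x v) D K))"

definition A1 :: "'a::euclidean_space set \<Rightarrow> bool" where
  "A1 \<Omega> \<longleftrightarrow> (\<forall>x\<in>\<Omega>. closed_segment 0 x \<subseteq> \<Omega>) \<and>
     (\<exists>\<kappa>>0. \<forall>s>0. \<forall>x \<in> (\<lambda>y. (1 + s) *\<^sub>R y) ` frontier \<Omega>. infdist x (closure \<Omega>) \<ge> \<kappa> * s)"

definition viscosity_subsolution ::
    "('a::euclidean_space \<Rightarrow> 'a \<Rightarrow> real) \<Rightarrow> real \<Rightarrow> 'a set \<Rightarrow> ('a \<Rightarrow> real) \<Rightarrow> bool" where
  "viscosity_subsolution F c \<Omega> u \<longleftrightarrow> continuous_on \<Omega> u \<and>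
     (\<forall>\<phi> D x. has_C1_gradient_on \<phi> D \<Omega> \<longrightarrow> x \<in> \<Omega> \<longrightarrow>
        (\<exists>r>0. \<forall>y \<in> \<Omega> \<inter> ball x r. u y - \<phi> y \<le> u x - \<phi> x) \<longrightarrow> F x (D x) \<le> c)"

definition additive_eigenvalue :: "('a::euclidean_space \<Rightarrow> 'a \<Rightarrow> real) \<Rightarrow> 'a set \<Rightarrow> real" where
  "additive_eigenvalue H \<Omega> = Inf {c. \<exists>v. viscosity_subsolution H c \<Omega> v}"

definition ham_of :: "real \<Rightarrow> ('a::euclidean_space \<times> 'a \<Rightarrow> real) \<Rightarrow> 'a \<Rightarrow> 'a \<Rightarrow> real" where
  "ham_of h f x p = (SUP v\<in>cball 0 h. p \<bullet> v - f (x, v))"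

text \<open>The normalization. A subsolution of \<open>H(x,Du) \<le> max H(\<cdot>,0)\<close> has gradient bounded by any \<open>C\<close>
  as in the first clause; this covers all solutions considered, because constants are
  subsolutions of \<open>H(x,Du) \<le> max H(\<cdot>,0)\<close>, whence \<open>c(0) \<le> max H(\<cdot>,0)\<close> and
  \<open>- \<phi>(\<lambda>) u\<^sub>\<lambda> \<le> max H(\<cdot>,0)\<close>. The modified Hamiltonian is \<open>sup\<^bsub>|v| \<le> h\<^esub> (p \<cdot> v - L(x,v))\<close> with the
  Lagrangian \<open>L\<close> of \<open>H\<close>; it equals \<open>H\<close> for \<open>|p| \<le> C\<close>, and its Lagrangian is again \<open>L\<close> on
  \<open>|v| \<le> h\<close>. Note that \<open>H\<close> itself is not assumed to be of this form.\<close>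

definition normalizing_radius ::
    "('a::euclidean_space \<Rightarrow> 'a \<Rightarrow> real) \<Rightarrow> 'a set \<Rightarrow> real \<Rightarrow> bool" where
  "normalizing_radius H K h \<longleftrightarrow> h > 0 \<and>
     (\<exists>C. (\<forall>x\<in>K. \<forall>p. H x p \<le> (SUP y\<in>K. H y 0) \<longrightarrow> norm p \<le> C) \<and>
          (\<forall>x\<in>K. \<forall>p. norm p \<le> C \<longrightarrow> H x p = ham_of h (\<lambda>(x, v). lagrangian H x v) x p))"

definition G0 :: "'a::euclidean_space set \<Rightarrow> real \<Rightarrow> ('a \<times> 'a \<Rightarrow> real) set" where
  "G0 \<Omega> h = {f. continuous_on (closure \<Omega> \<times> cball 0 h) f \<and>
     (\<exists>u. continuous_on (closure \<Omega>) u \<and> viscosity_subsolution (ham_of h f) 0 \<Omega> u)}"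

text \<open>Finite Borel measures on the compact set \<open>closure \<Omega> \<times> cball 0 h\<close> are Radon. Restricting to
  positive measures loses nothing: \<open>G0 \<Omega> h\<close> contains all nonnegative continuous functions.\<close>

definition G0_dual :: "'a::euclidean_space set \<Rightarrow> real \<Rightarrow> ('a \<times> 'a) measure set" where
  "G0_dual \<Omega> h = {\<mu>. sets \<mu> = sets (restrict_space borel (closure \<Omega> \<times> cball 0 h)) \<and>
     finite_measure \<mu> \<and> (\<forall>f\<in>G0 \<Omega> h. 0 \<le> (\<integral>z. f z \<partial>\<mu>))}"

definition mather_measures ::
    "('a::euclidean_space \<Rightarrow> 'a \<Rightarrow> real) \<Rightarrow> 'a set \<Rightarrow> real \<Rightarrow> ('a \<times> 'a) measure set" where
  "mather_measures H \<Omega> h = {\<mu> \<in> G0_dual \<Omega> h. prob_space \<mu> \<and>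
     (\<integral>(x, v). lagrangian H x v \<partial>\<mu>) = - additive_eigenvalue H \<Omega>}"

definition E_gamma ::
    "('a::euclidean_space \<Rightarrow> 'a \<Rightarrow> real) \<Rightarrow> 'a set \<Rightarrow> real \<Rightarrow> real \<Rightarrow> ('a \<Rightarrow> real) set" where
  "E_gamma H \<Omega> h \<gamma> = {w. continuous_on (closure \<Omega>) w \<and>
     viscosity_subsolution H (additive_eigenvalue H \<Omega>) \<Omega> w \<and>
     (\<forall>\<mu>\<in>mather_measures H \<Omega> h.
        \<gamma> * (\<integral>(x, v). (- x) \<bullet> lagrangian_Dx H x v \<partial>\<mu>) + (\<integral>(x, v). w x \<partial>\<mu>) \<le> 0)}"

definition u_gamma ::
    "('a::euclidean_space \<Rightarrow> 'a \<Rightarrow> real) \<Rightarrow> 'a set \<Rightarrow> real \<Rightarrow> real \<Rightarrow> 'a \<Rightarrow> real" where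
  "u_gamma H \<Omega> h \<gamma> x = (SUP w\<in>E_gamma H \<Omega> h \<gamma>. w x)"

end

theory Submission
  imports Defs
begin

text \<open>Subsolutions at level \<open>c(0)\<close> form a convex set, because \<open>H\<close> is convex in \<open>p\<close>, and they are
  Lipschitz on \<open>closure \<Omega>\<close> with a common constant, because \<open>H\<close> is coercive and \<open>\<Omega>\<close> is
  quantitatively star-shaped. As the constraint defining \<open>E\<^sup>\<gamma>\<close> is jointly affine in \<open>(\<gamma>, w)\<close>,
  continuity and concavity follow. Monotonicity amounts to \<open>\<langle>\<mu>, (- x) \<cdot> D\<^sub>x L\<rangle> \<ge> 0\<close> for Mather
  measures: dilating a subsolution shows that \<open>L((1 - s) x, v) + c(0)\<close> is admissible in the
  definition of the dual cone, so that \<open>\<langle>\<mu>, L((1 - s) x, v)\<rangle>\<close> is minimal at \<open>s = 0\<close>.\<close>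

section \<open>Viscosity subsolutions\<close>

text \<open>All arguments work with test functions directly, without differentiability almost
  everywhere or mollification. Convexity of the set of subsolutions is then the delicate point: a
  test function touching \<open>(1 - t) u + t v\<close> touches neither \<open>u\<close> nor
  \<open>v\<close>. The variables are doubled with a quadratic penalty; the slopes seen by
  \<open>u\<close> and \<open>v\<close> contain penalty terms of unknown size, and coercivity is
  what keeps these slopes bounded. The common Lipschitz constant serves twice: it passes to the
  supremum, and it turns the constraint, which controls only the mean of \<open>w\<close> against a
  Mather measure, into a pointwise upper bound. The truncation \<open>|v| <= h\<close> in
  \<open>ham_of\<close> enters through one inequality: a supremum over fewer vectors is at most the
  full Legendre transform of the Lagrangian, hence at most \<open>H\<close>. Since
  \<open>SUP\<close> is total on the reals, the set behind \<open>u_gamma\<close> has to be shown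
  nonempty and bounded above; this rests on a subsolution and a Mather measure, and without either
  of them \<open>u_gamma\<close> is a constant independent of \<gamma>.\<close>

lemma has_C1_gradient_on_add:
  assumes "has_C1_gradient_on f D S" "has_C1_gradient_on g E S"
  shows "has_C1_gradient_on (\<lambda>x. f x + g x) (\<lambda>x. D x + E x) S"
  using assms unfolding has_C1_gradient_on_def
  by (auto simp: inner_add_right intro!: continuous_intros has_derivative_add)

lemma has_C1_gradient_on_scaled_sq_norm:
  "has_C1_gradient_on (\<lambda>x. a * (norm (x - u))\<^sup>2) (\<lambda>x. (2 * a) *\<^sub>R (x - u)) S"
  unfolding has_C1_gradient_on_def power2_norm_eq_inner
  by (auto intro!: continuous_intros derivative_eq_intros simp: inner_commute algebra_simps)

lemma has_C1_gradient_on_subset: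
  "has_C1_gradient_on f D S \<Longrightarrow> T \<subseteq> S \<Longrightarrow> has_C1_gradient_on f D T"
  unfolding has_C1_gradient_on_def
  by (auto intro: continuous_on_subset has_derivative_subset)

lemma has_C1_gradient_on_imp_continuous_on:
  "has_C1_gradient_on f D S \<Longrightarrow> continuous_on S f"
  unfolding has_C1_gradient_on_def continuous_on_eq_continuous_within
  by (blast intro: has_derivative_continuous)

lemma viscosity_subsolutionD:
  assumes "viscosity_subsolution F c \<Omega> u" "has_C1_gradient_on \<phi> D \<Omega>" "x \<in> \<Omega>"
    and "r > 0" "\<And>y. y \<in> \<Omega> \<Longrightarrow> y \<in> ball x r \<Longrightarrow> u y - \<phi> y \<le> u x - \<phi> x"
  shows "F x (D x) \<le> c"
  using assms unfolding viscosity_subsolution_def by blast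

lemma viscosity_subsolution_add_const:
  assumes "viscosity_subsolution F c \<Omega> u"
  shows "viscosity_subsolution F c \<Omega> (\<lambda>x. u x + a)"
  unfolding viscosity_subsolution_def
proof (intro conjI allI impI)
  show "continuous_on \<Omega> (\<lambda>x. u x + a)"
    using assms unfolding viscosity_subsolution_def by (intro continuous_intros) auto
  fix \<phi> D x assume "has_C1_gradient_on \<phi> D \<Omega>" "x \<in> \<Omega>"
    "\<exists>r>0. \<forall>y\<in>\<Omega> \<inter> ball x r. u y + a - \<phi> y \<le> u x + a - \<phi> x"
  then show "F x (D x) \<le> c"
    using viscosity_subsolutionD[OF assms, of \<phi> D x] by force
qed

section \<open>Doubling of variables and convex combinations of subsolutions\<close>

text \<open>The maximizers of \<open>G (x, y) - n |x - y|^2\<close> beat \<open>(x0, x0)\<close>,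
  where the penalty vanishes, so the penalty stays bounded by the oscillation of \<open>G\<close>
  and cluster points lie on the diagonal. There \<open>G\<close> is at least
  \<open>G (x0, x0)\<close>, and strictness leaves only \<open>(x0, x0)\<close>. The final
  inequality lets each variable be varied alone.\<close>

lemma doubling_maximizers:
  fixes G :: "'a::euclidean_space \<times> 'a \<Rightarrow> real"
  assumes r: "r > 0" and cont: "continuous_on (cball x0 r \<times> cball x0 r) G"
    and strict: "\<And>x. x \<in> cball x0 r \<Longrightarrow> x \<noteq> x0 \<Longrightarrow> G (x, x) < G (x0, x0)"
  obtains x y :: "nat \<Rightarrow> 'a" and k :: "nat \<Rightarrow> real"
  where "x \<longlonglongrightarrow> x0" "y \<longlonglongrightarrow> x0" "\<And>n. x n \<in> ball x0 r" "\<And>n. y n \<in> ball x0 r"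
    "\<And>n x' y'. x' \<in> cball x0 r \<Longrightarrow> y' \<in> cball x0 r \<Longrightarrow>
      G (x', y') - k n * (norm (x' - y'))\<^sup>2 \<le> G (x n, y n) - k n * (norm (x n - y n))\<^sup>2"
proof -
  let ?Q = "cball x0 r \<times> cball x0 r"
  have comp: "compact ?Q" by (intro compact_Times compact_cball)
  have x0Q: "(x0, x0) \<in> ?Q" using r by auto
  have "\<exists>z\<in>?Q. \<forall>z'\<in>?Q. G z' - real n * (norm (fst z' - snd z'))\<^sup>2
      \<le> G z - real n * (norm (fst z - snd z))\<^sup>2" for n
    by (rule continuous_attains_sup[OF comp]) (use x0Q in \<open>auto intro!: continuous_intros cont\<close>)
  then obtain z where zQ: "\<And>n. z n \<in> ?Q"
    and zmax: "\<And>n z'. z' \<in> ?Q \<Longrightarrow> G z' - real n * (norm (fst z' - snd z'))\<^sup>2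
      \<le> G (z n) - real n * (norm (fst (z n) - snd (z n)))\<^sup>2" by metis
  have "compact (G ` ?Q)" by (rule compact_continuous_image[OF cont comp])
  then obtain B where B: "\<And>q. q \<in> ?Q \<Longrightarrow> \<bar>G q\<bar> \<le> B"
    using compact_imp_bounded[of "G ` ?Q"] unfolding bounded_iff by auto
  have low: "G (x0, x0) + real n * (norm (fst (z n) - snd (z n)))\<^sup>2 \<le> G (z n)" for n
    using zmax[OF x0Q, of n] by simp
  have Gz: "G (x0, x0) \<le> G (z n)" for n
    using low[of n] by (smt (verit) mult_nonneg_nonneg of_nat_0_le_iff zero_le_power2)
  have sq: "(norm (fst (z n) - snd (z n)))\<^sup>2 \<le> 2 * B / real n" if "n > 0" for n
    using low[of n] B[OF zQ[of n]] B[OF x0Q] that by (simp add: field_simps)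
  obtain l \<rho> where l: "l \<in> ?Q" "strict_mono \<rho>" "(z \<circ> \<rho>) \<longlonglongrightarrow> l"
    using seq_compactE[of ?Q z] comp zQ unfolding compact_eq_seq_compact_metric by blast
  then have lim: "(\<lambda>n. z (\<rho> n)) \<longlonglongrightarrow> l" by (simp add: o_def)
  have "(\<lambda>n. 2 * B / real n) \<longlonglongrightarrow> 0" by (rule lim_const_over_n)
  then have "(\<lambda>n. 2 * B / real (\<rho> n)) \<longlonglongrightarrow> 0"
    by (rule LIMSEQ_subseq_LIMSEQ[OF _ l(2), unfolded o_def])
  moreover have "(\<lambda>n. (norm (fst (z (\<rho> n)) - snd (z (\<rho> n))))\<^sup>2) \<longlonglongrightarrow> (norm (fst l - snd l))\<^sup>2"
    by (intro tendsto_intros lim)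
  moreover have "\<forall>\<^sub>F n in sequentially. (norm (fst (z (\<rho> n)) - snd (z (\<rho> n))))\<^sup>2 \<le> 2 * B / real (\<rho> n)"
    using eventually_gt_at_top[of 0]
  proof eventually_elim
    case (elim n)
    then have "\<rho> n > 0" using seq_suble[OF l(2), of n] by linarith
    then show ?case by (rule sq)
  qed
  ultimately have "(norm (fst l - snd l))\<^sup>2 \<le> 0"
    using tendsto_le[OF trivial_limit_sequentially] by blast
  then have eq: "fst l = snd l" by simp
  have "(\<lambda>n. G (z (\<rho> n))) \<longlonglongrightarrow> G l"
    using continuous_on_tendsto_compose[OF cont lim l(1)] zQ by simp
  then have "G (x0, x0) \<le> G l"
    by (rule tendsto_lowerbound) (auto simp: Gz)
  then have l_eq: "l = (x0, x0)"
    using strict[of "fst l"] eq l(1) by (metis linorder_not_le mem_Sigma_iff prod.collapse)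
  have lim1: "(\<lambda>n. fst (z (\<rho> n))) \<longlonglongrightarrow> x0" and lim2: "(\<lambda>n. snd (z (\<rho> n))) \<longlonglongrightarrow> x0"
    using tendsto_fst[OF lim] tendsto_snd[OF lim] l_eq by auto
  have "\<forall>\<^sub>F n in sequentially. fst (z (\<rho> n)) \<in> ball x0 r \<and> snd (z (\<rho> n)) \<in> ball x0 r"
    using topological_tendstoD[OF lim1, of "ball x0 r"] topological_tendstoD[OF lim2, of "ball x0 r"] r
    by (auto intro: eventually_conj)
  then obtain N where N: "\<And>n. n \<ge> N \<Longrightarrow> fst (z (\<rho> n)) \<in> ball x0 r \<and> snd (z (\<rho> n)) \<in> ball x0 r"
    unfolding eventually_sequentially by blast
  \<comment> \<open>Finitely many maximizers may lie on the boundary; the shift by \<open>N\<close>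
    discards them, because interior points are required for every index.\<close>
  show ?thesis
  proof (rule that[of "\<lambda>n. fst (z (\<rho> (n + N)))" "\<lambda>n. snd (z (\<rho> (n + N)))" "\<lambda>n. real (\<rho> (n + N))"])
    show "(\<lambda>n. fst (z (\<rho> (n + N)))) \<longlonglongrightarrow> x0" using LIMSEQ_ignore_initial_segment[OF lim1] .
    show "(\<lambda>n. snd (z (\<rho> (n + N)))) \<longlonglongrightarrow> x0" using LIMSEQ_ignore_initial_segment[OF lim2] .
    show "fst (z (\<rho> (n + N))) \<in> ball x0 r" "snd (z (\<rho> (n + N))) \<in> ball x0 r" for n
      using N[of "n + N"] by auto
    show "G (x', y') - real (\<rho> (n + N)) * (norm (x' - y'))\<^sup>2
      \<le> G (fst (z (\<rho> (n + N))), snd (z (\<rho> (n + N))))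
        - real (\<rho> (n + N)) * (norm (fst (z (\<rho> (n + N))) - snd (z (\<rho> (n + N)))))\<^sup>2"
      if "x' \<in> cball x0 r" "y' \<in> cball x0 r" for n x' y'
      using zmax[of "(x', y')" "\<rho> (n + N)"] that by simp
  qed
qed

text \<open>Test functions are required to be differentiable on all of \<open>\<Omega>\<close>; doubling the variables
  transfers the contact to a quadratic, so that a test function near the contact point suffices.\<close>

lemma viscosity_subsolution_local_test:
  fixes F :: "'a::euclidean_space \<Rightarrow> 'a \<Rightarrow> real"
  assumes sub: "viscosity_subsolution F c \<Omega> w" and op: "open \<Omega>"
    and contF: "continuous_on (\<Omega> \<times> UNIV) (\<lambda>(x, p). F x p)"
    and x0: "x0 \<in> \<Omega>" and r: "r > 0" and \<psi>: "has_C1_gradient_on \<psi> D (ball x0 r)"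
    and max: "\<And>y. y \<in> ball x0 r \<Longrightarrow> y \<in> \<Omega> \<Longrightarrow> w y - \<psi> y \<le> w x0 - \<psi> x0"
  shows "F x0 (D x0) \<le> c"
proof -
  obtain r1 where r1: "r1 > 0" "cball x0 r1 \<subseteq> \<Omega>" using op x0 open_contains_cball by blast
  define \<delta> where "\<delta> = min r1 (r / 2)"
  have \<delta>: "\<delta> > 0" "cball x0 \<delta> \<subseteq> \<Omega>" "cball x0 \<delta> \<subseteq> ball x0 r"
    using r1 r unfolding \<delta>_def by (auto simp: subset_eq)
  have contw: "continuous_on \<Omega> w" using sub unfolding viscosity_subsolution_def by blast
  have cont\<psi>: "continuous_on (ball x0 r) \<psi>" by (rule has_C1_gradient_on_imp_continuous_on[OF \<psi>])
  have contD: "continuous_on (ball x0 r) D" using \<psi> unfolding has_C1_gradient_on_def by blast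
  \<comment> \<open>\<open>w\<close> depends on \<open>y\<close> and \<open>\<psi>\<close> on
    \<open>x\<close>: with \<open>x\<close> frozen, \<open>w\<close> is touched at
    \<open>y n\<close> by the quadratic \<open>k n |y - x n|^2\<close>, a test function on all of
    \<open>\<Omega>\<close>; with \<open>y\<close> frozen, stationarity in \<open>x\<close>
    identifies its slope. The term \<open>|x - x0|^2\<close> makes the maximum at \<open>x0\<close>
    strict.\<close>
  define G where "G = (\<lambda>(x, y). w y - \<psi> x - (norm (x - x0))\<^sup>2)"
  have contG: "continuous_on (cball x0 \<delta> \<times> cball x0 \<delta>) G"
    unfolding G_def split_def
    by (intro continuous_intros continuous_on_compose2[OF contw] continuous_on_compose2[OF cont\<psi>])
      (use \<delta> in auto)
  have strict: "G (x, x) < G (x0, x0)" if "x \<in> cball x0 \<delta>" "x \<noteq> x0" for x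
  proof -
    have "w x - \<psi> x \<le> w x0 - \<psi> x0" using max[of x] that \<delta> by blast
    moreover have "(norm (x - x0))\<^sup>2 > 0" using that by simp
    moreover have "G (x, x) = w x - \<psi> x - (norm (x - x0))\<^sup>2" "G (x0, x0) = w x0 - \<psi> x0"
      unfolding G_def by simp_all
    ultimately show ?thesis by linarith
  qed
  obtain x y k where lim: "x \<longlonglongrightarrow> x0" "y \<longlonglongrightarrow> x0"
    and inb: "\<And>n. x n \<in> ball x0 \<delta>" "\<And>n. y n \<in> ball x0 \<delta>"
    and opt: "\<And>n x' y'. x' \<in> cball x0 \<delta> \<Longrightarrow> y' \<in> cball x0 \<delta> \<Longrightarrow>
      G (x', y') - k n * (norm (x' - y'))\<^sup>2 \<le> G (x n, y n) - k n * (norm (x n - y n))\<^sup>2"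
    using doubling_maximizers[OF \<delta>(1) contG strict] by blast
  have eq: "(2 * k n) *\<^sub>R (y n - x n) = D (x n) + 2 *\<^sub>R (x n - x0)" for n
  proof -
    let ?f = "\<lambda>x. \<psi> x + 1 * (norm (x - x0))\<^sup>2 + k n * (norm (x - y n))\<^sup>2"
    let ?E = "\<lambda>x. D x + (2 * 1) *\<^sub>R (x - x0) + (2 * k n) *\<^sub>R (x - y n)"
    have "has_C1_gradient_on ?f ?E (ball x0 r)"
      by (intro has_C1_gradient_on_add \<psi> has_C1_gradient_on_scaled_sq_norm)
    moreover have xn: "x n \<in> ball x0 r" using inb \<delta> by (meson ball_subset_cball subsetD)
    ultimately have "(?f has_derivative (\<lambda>y. y \<bullet> ?E (x n))) (at (x n) within ball x0 r)"
      unfolding has_C1_gradient_on_def by blast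
    then have der: "(?f has_derivative (\<lambda>y. y \<bullet> ?E (x n))) (at (x n))"
      using at_within_open[OF xn] by simp
    have "?f (x n) \<le> ?f z" if "z \<in> ball x0 \<delta>" for z
      using opt[of z "y n" n] inb(2)[of n] that unfolding G_def by auto
    then have "(\<lambda>y. y \<bullet> ?E (x n)) = (\<lambda>y. 0)"
      using differential_zero_maxmin[of "x n" "ball x0 \<delta>" ?f "\<lambda>y. y \<bullet> ?E (x n)"] inb(1)[of n] der by auto
    then have "?E (x n) \<bullet> ?E (x n) = 0" by meson
    then have "?E (x n) = 0" by simp
    then show ?thesis by (simp add: algebra_simps add_eq_0_iff2 eq_neg_iff_add_eq_0)
  qed
  have le: "F (y n) (D (x n) + 2 *\<^sub>R (x n - x0)) \<le> c" for n
  proof -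
    obtain e where e: "e > 0" "ball (y n) e \<subseteq> ball x0 \<delta>"
      by (rule openE[OF open_ball inb(2)[of n]])
    have "F (y n) ((2 * k n) *\<^sub>R (y n - x n)) \<le> c"
    proof (rule viscosity_subsolutionD[OF sub has_C1_gradient_on_scaled_sq_norm _ e(1)])
      show "y n \<in> \<Omega>" using inb(2) \<delta> by (meson ball_subset_cball subsetD)
      fix z assume "z \<in> ball (y n) e"
      then have "z \<in> cball x0 \<delta>" using e by (meson ball_subset_cball subsetD)
      then show "w z - k n * (norm (z - x n))\<^sup>2 \<le> w (y n) - k n * (norm (y n - x n))\<^sup>2"
        using opt[of "x n" z n] inb(1)[of n] unfolding G_def
        by (simp add: norm_minus_commute[of _ "x n"])
    qed
    then show ?thesis using eq by simp
  qed
  have "x n \<in> ball x0 r" for n using inb(1)[of n] \<delta>(3) by (meson ball_subset_cball subsetD)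
  then have "(\<lambda>n. D (x n)) \<longlonglongrightarrow> D x0"
    using continuous_on_tendsto_compose[OF contD lim(1)] r by simp
  then have "(\<lambda>n. D (x n) + 2 *\<^sub>R (x n - x0)) \<longlonglongrightarrow> D x0 + 2 *\<^sub>R (x0 - x0)"
    by (intro tendsto_intros lim)
  then have "(\<lambda>n. (y n, D (x n) + 2 *\<^sub>R (x n - x0))) \<longlonglongrightarrow> (x0, D x0)"
    using lim by (auto intro: tendsto_Pair)
  moreover have "y n \<in> \<Omega>" for n using inb(2) \<delta> by (meson ball_subset_cball subsetD)
  ultimately have "(\<lambda>n. F (y n) (D (x n) + 2 *\<^sub>R (x n - x0))) \<longlonglongrightarrow> F x0 (D x0)"
    using continuous_on_tendsto_compose[OF contF, of "\<lambda>n. (y n, D (x n) + 2 *\<^sub>R (x n - x0))"] x0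
    by force
  then show ?thesis by (rule tendsto_upperbound) (auto simp: le)
qed

text \<open>Doubling lets \<open>u\<close> and \<open>v\<close> be tested at separate points
  \<open>x n\<close>, \<open>y n\<close> with slopes \<open>p n\<close>, \<open>q n\<close>.
  Coercivity bounds both slopes, so \<open>H1\<close> moves the base point to \<open>x0\<close> with
  one constant for all \<open>n\<close>, and convexity in \<open>p\<close> is applied only at
  \<open>x0\<close>.\<close>

lemma viscosity_subsolution_convex_combination:
  fixes H :: "'a::euclidean_space \<Rightarrow> 'a \<Rightarrow> real"
  assumes u: "viscosity_subsolution H c \<Omega> u" and v: "viscosity_subsolution H c \<Omega> v"
    and t: "t \<in> {0..1}" and op: "open \<Omega>" and sub: "\<Omega> \<subseteq> K" and H1: "H1 H K" and H3: "H3 H K"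
    and coercive: "\<And>x p. x \<in> \<Omega> \<Longrightarrow> H x p \<le> c \<Longrightarrow> norm p \<le> C"
  shows "viscosity_subsolution H c \<Omega> (\<lambda>x. (1 - t) * u x + t * v x)"
proof (cases "t = 0 \<or> t = 1")
  case True
  then show ?thesis using u v by auto
next
  case False
  then have t: "0 < t" "t < 1" using t by auto
  have contu: "continuous_on \<Omega> u" and contv: "continuous_on \<Omega> v"
    using u v unfolding viscosity_subsolution_def by blast+
  show ?thesis
    unfolding viscosity_subsolution_def
  proof (intro conjI allI impI)
    show "continuous_on \<Omega> (\<lambda>x. (1 - t) * u x + t * v x)"
      by (intro continuous_intros contu contv)
    fix \<phi> D x0 assume \<phi>: "has_C1_gradient_on \<phi> D \<Omega>" and x0: "x0 \<in> \<Omega>"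
      and "\<exists>r>0. \<forall>y\<in>\<Omega> \<inter> ball x0 r.
        (1 - t) * u y + t * v y - \<phi> y \<le> (1 - t) * u x0 + t * v x0 - \<phi> x0"
    then obtain r where r: "r > 0" and max: "\<And>y. y \<in> \<Omega> \<Longrightarrow> y \<in> ball x0 r \<Longrightarrow>
        (1 - t) * u y + t * v y - \<phi> y \<le> (1 - t) * u x0 + t * v x0 - \<phi> x0" by auto
    obtain r1 where r1: "r1 > 0" "cball x0 r1 \<subseteq> \<Omega>" using op x0 open_contains_cball by blast
    define \<delta> where "\<delta> = min r1 (r / 2)"
    have \<delta>: "\<delta> > 0" "cball x0 \<delta> \<subseteq> \<Omega>" "cball x0 \<delta> \<subseteq> ball x0 r"
      using r1 r unfolding \<delta>_def by (auto simp: subset_eq)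
    have cont\<phi>: "continuous_on \<Omega> \<phi>" by (rule has_C1_gradient_on_imp_continuous_on[OF \<phi>])
    have contD: "continuous_on \<Omega> D" using \<phi> unfolding has_C1_gradient_on_def by blast
    define G where "G = (\<lambda>(x, y). (1 - t) * (u x - \<phi> x - (norm (x - x0))\<^sup>2)
        + t * (v y - \<phi> y - (norm (y - x0))\<^sup>2))"
    have contG: "continuous_on (cball x0 \<delta> \<times> cball x0 \<delta>) G"
      unfolding G_def split_def
      by (intro continuous_intros continuous_on_compose2[OF contu] continuous_on_compose2[OF contv]
          continuous_on_compose2[OF cont\<phi>]) (use \<delta> in auto)
    have strict: "G (x, x) < G (x0, x0)" if "x \<in> cball x0 \<delta>" "x \<noteq> x0" for x
    proof -
      have "(1 - t) * u x + t * v x - \<phi> x \<le> (1 - t) * u x0 + t * v x0 - \<phi> x0"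
        using max[of x] that \<delta> by blast
      moreover have "(norm (x - x0))\<^sup>2 > 0" using that by simp
      moreover have "G (x, x) = (1 - t) * u x + t * v x - \<phi> x - (norm (x - x0))\<^sup>2"
        "G (x0, x0) = (1 - t) * u x0 + t * v x0 - \<phi> x0"
        unfolding G_def by (simp_all add: algebra_simps)
      ultimately show ?thesis by linarith
    qed
    obtain x y k where lim: "x \<longlonglongrightarrow> x0" "y \<longlonglongrightarrow> x0"
      and inb: "\<And>n. x n \<in> ball x0 \<delta>" "\<And>n. y n \<in> ball x0 \<delta>"
      and opt: "\<And>n x' y'. x' \<in> cball x0 \<delta> \<Longrightarrow> y' \<in> cball x0 \<delta> \<Longrightarrow>
        G (x', y') - k n * (norm (x' - y'))\<^sup>2 \<le> G (x n, y n) - k n * (norm (x n - y n))\<^sup>2"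
      using doubling_maximizers[OF \<delta>(1) contG strict] by blast
    have x\<Omega>: "x n \<in> \<Omega>" and y\<Omega>: "y n \<in> \<Omega>" for n
      using inb \<delta> by (meson ball_subset_cball subsetD)+
    \<comment> \<open>The factors \<open>1 / (1 - t)\<close> and \<open>1 / t\<close> come from
      dividing the doubled inequality by the weight of the function tested; they make the penalty
      terms cancel in \<open>(1 - t) p + t q\<close>, whatever the size of
      \<open>k n\<close>.\<close>
    define p where "p n = D (x n) + (2 * 1) *\<^sub>R (x n - x0) + (2 * (k n / (1 - t))) *\<^sub>R (x n - y n)" for n
    define q where "q n = D (y n) + (2 * 1) *\<^sub>R (y n - x0) + (2 * (k n / t)) *\<^sub>R (y n - x n)" for n
    have Hp: "H (x n) (p n) \<le> c" for n
    proof -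
      obtain e where e: "e > 0" "ball (x n) e \<subseteq> ball x0 \<delta>"
        by (rule openE[OF open_ball inb(1)[of n]])
      let ?f = "\<lambda>x. \<phi> x + 1 * (norm (x - x0))\<^sup>2 + (k n / (1 - t)) * (norm (x - y n))\<^sup>2"
      have C1: "has_C1_gradient_on ?f
          (\<lambda>x. D x + (2 * 1) *\<^sub>R (x - x0) + (2 * (k n / (1 - t))) *\<^sub>R (x - y n)) \<Omega>"
        by (intro has_C1_gradient_on_add \<phi> has_C1_gradient_on_scaled_sq_norm)
      show ?thesis
        unfolding p_def
      proof (rule viscosity_subsolutionD[OF u C1 x\<Omega> e(1)])
        fix z assume "z \<in> ball (x n) e"
        then have z: "z \<in> cball x0 \<delta>" using e by (meson ball_subset_cball subsetD)
        have "y n \<in> cball x0 \<delta>" using inb(2)[of n] by simp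
        note opt[OF z this, of n]
        moreover have "(1 - t) * (u a - ?f a)
            = (1 - t) * (u a - \<phi> a - (norm (a - x0))\<^sup>2) - k n * (norm (a - y n))\<^sup>2" for a
          using t by (simp add: right_diff_distrib distrib_left)
        ultimately have "(1 - t) * (u z - ?f z) \<le> (1 - t) * (u (x n) - ?f (x n))"
          unfolding G_def by simp
        then show "u z - ?f z \<le> u (x n) - ?f (x n)"
          using t by (simp only: mult_le_cancel_left_pos diff_gt_0_iff_gt)
      qed
    qed
    have Hq: "H (y n) (q n) \<le> c" for n
    proof -
      obtain e where e: "e > 0" "ball (y n) e \<subseteq> ball x0 \<delta>"
        by (rule openE[OF open_ball inb(2)[of n]])
      let ?f = "\<lambda>y. \<phi> y + 1 * (norm (y - x0))\<^sup>2 + (k n / t) * (norm (y - x n))\<^sup>2"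
      have C1: "has_C1_gradient_on ?f
          (\<lambda>y. D y + (2 * 1) *\<^sub>R (y - x0) + (2 * (k n / t)) *\<^sub>R (y - x n)) \<Omega>"
        by (intro has_C1_gradient_on_add \<phi> has_C1_gradient_on_scaled_sq_norm)
      show ?thesis
        unfolding q_def
      proof (rule viscosity_subsolutionD[OF v C1 y\<Omega> e(1)])
        fix z assume "z \<in> ball (y n) e"
        then have z: "z \<in> cball x0 \<delta>" using e by (meson ball_subset_cball subsetD)
        have "x n \<in> cball x0 \<delta>" using inb(1)[of n] by simp
        note opt[OF this z, of n]
        moreover have "t * (v a - ?f a)
            = t * (v a - \<phi> a - (norm (a - x0))\<^sup>2) - k n * (norm (x n - a))\<^sup>2" for a
          using t by (simp add: right_diff_distrib distrib_left norm_minus_commute[of a "x n"])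
        ultimately have "t * (v z - ?f z) \<le> t * (v (y n) - ?f (y n))"
          unfolding G_def by simp
        then show "v z - ?f z \<le> v (y n) - ?f (y n)"
          using t by (simp only: mult_le_cancel_left_pos)
      qed
    qed
    have comb: "(1 - t) *\<^sub>R p n + t *\<^sub>R q n
        = (1 - t) *\<^sub>R (D (x n) + 2 *\<^sub>R (x n - x0)) + t *\<^sub>R (D (y n) + 2 *\<^sub>R (y n - x0))" for n
    proof -
      have "(1 - t) *\<^sub>R ((2 * (k n / (1 - t))) *\<^sub>R (x n - y n)) = (2 * k n) *\<^sub>R (x n - y n)"
        "t *\<^sub>R ((2 * (k n / t)) *\<^sub>R (y n - x n)) = - ((2 * k n) *\<^sub>R (x n - y n))"
        using t by (auto simp flip: scaleR_minus_right)
      then show ?thesis unfolding p_def q_def scaleR_add_right by simp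
    qed
    have "(\<lambda>n. D (x n)) \<longlonglongrightarrow> D x0" "(\<lambda>n. D (y n)) \<longlonglongrightarrow> D x0"
      using continuous_on_tendsto_compose[OF contD lim(1) x0]
        continuous_on_tendsto_compose[OF contD lim(2) x0] x\<Omega> y\<Omega> by simp_all
    then have "(\<lambda>n. (1 - t) *\<^sub>R p n + t *\<^sub>R q n)
        \<longlonglongrightarrow> (1 - t) *\<^sub>R (D x0 + 2 *\<^sub>R (x0 - x0)) + t *\<^sub>R (D x0 + 2 *\<^sub>R (x0 - x0))"
      unfolding comb by (intro tendsto_intros lim)
    then have limp: "(\<lambda>n. (1 - t) *\<^sub>R p n + t *\<^sub>R q n) \<longlonglongrightarrow> D x0"
      by (simp add: algebra_simps)
    define R where "R = \<bar>C\<bar> + 1"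
    have pR: "norm (p n) \<le> R" "norm (q n) \<le> R" for n
      using coercive[OF x\<Omega> Hp, of n] coercive[OF y\<Omega> Hq, of n] unfolding R_def by linarith+
    obtain CR where CR: "\<And>x y p. x \<in> K \<Longrightarrow> y \<in> K \<Longrightarrow> norm p \<le> R \<Longrightarrow> \<bar>H x p - H y p\<bar> \<le> CR * norm (x - y)"
    proof -
      have "R > 0" unfolding R_def by simp
      then show ?thesis using H1 that unfolding H1_def by blast
    qed
    have conv: "convex_on UNIV (H x0)" using H3 x0 sub unfolding H3_def by auto
    have bound: "H x0 ((1 - t) *\<^sub>R p n + t *\<^sub>R q n)
        \<le> c + ((1 - t) * (CR * norm (x n - x0)) + t * (CR * norm (y n - x0)))" for n
    proof -
      have "H x0 ((1 - t) *\<^sub>R p n + t *\<^sub>R q n) \<le> (1 - t) * H x0 (p n) + t * H x0 (q n)"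
        using convex_onD[OF conv, of t "p n" "q n"] t by simp
      also have "\<dots> \<le> (1 - t) * (c + CR * norm (x n - x0)) + t * (c + CR * norm (y n - x0))"
      proof (intro add_mono mult_left_mono)
        show "H x0 (p n) \<le> c + CR * norm (x n - x0)"
          using CR[of "x n" x0 "p n"] Hp[of n] pR x\<Omega> x0 sub by fastforce
        show "H x0 (q n) \<le> c + CR * norm (y n - x0)"
          using CR[of "y n" x0 "q n"] Hq[of n] pR y\<Omega> x0 sub by fastforce
      qed (use t in auto)
      finally show ?thesis by (simp add: algebra_simps)
    qed
    have "continuous_on UNIV (H x0)"
      by (rule convex_on_continuous[OF open_UNIV conv])
    then have "(\<lambda>n. H x0 ((1 - t) *\<^sub>R p n + t *\<^sub>R q n)) \<longlonglongrightarrow> H x0 (D x0)"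
      using continuous_on_tendsto_compose[of UNIV "H x0", OF _ limp] by simp
    moreover have "(\<lambda>n. c + ((1 - t) * (CR * norm (x n - x0)) + t * (CR * norm (y n - x0))))
        \<longlonglongrightarrow> c + ((1 - t) * (CR * norm (x0 - x0)) + t * (CR * norm (x0 - x0)))"
      by (intro tendsto_intros lim)
    ultimately show "H x0 (D x0) \<le> c"
      using LIMSEQ_le[of _ "H x0 (D x0)"] bound by fastforce
  qed
qed

section \<open>Interior Lipschitz estimates\<close>

text \<open>Let \<open>x\<close> maximize \<open>w - C |y - z| - K |y - z|^2\<close>. On the sphere
  \<open>2 M <= K r^2\<close> pushes the value down to at most that at the centre. At any other
  point except \<open>z\<close> the slope would have norm \<open>C + 2 K |x - z|\<close>, more than
  the bound \<open>C\<close> permits.\<close>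

lemma viscosity_subsolution_cone_bound:
  fixes w :: "'a::euclidean_space \<Rightarrow> real"
  assumes sub: "viscosity_subsolution F c \<Omega> w"
    and C: "C \<ge> 0" "\<And>x p. x \<in> \<Omega> \<Longrightarrow> F x p \<le> c \<Longrightarrow> norm p \<le> C"
    and r: "r > 0" "cball z r \<subseteq> \<Omega>" and M: "\<And>y. y \<in> cball z r \<Longrightarrow> \<bar>w y\<bar> \<le> M"
    and K: "K > 0" "2 * M \<le> K * r\<^sup>2" and y: "y \<in> cball z r"
  shows "w y \<le> w z + C * norm (y - z) + K * (norm (y - z))\<^sup>2"
proof -
  define q where "q y = w y - C * norm (y - z) - K * (norm (y - z))\<^sup>2" for y
  have "continuous_on (cball z r) w"
    using sub r(2) unfolding viscosity_subsolution_def by (meson continuous_on_subset)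
  then have "continuous_on (cball z r) q"
    unfolding q_def by (intro continuous_intros)
  then obtain x where x: "x \<in> cball z r" and max: "\<And>y. y \<in> cball z r \<Longrightarrow> q y \<le> q x"
    using continuous_attains_sup[OF compact_cball, of z r q] r by auto
  have "q x \<le> q z"
  proof (rule ccontr)
    assume less: "\<not> q x \<le> q z"
    define \<rho> where "\<rho> = norm (x - z)"
    have "x \<noteq> z" using less by auto
    then have \<rho>: "\<rho> > 0" unfolding \<rho>_def by simp
    have "\<rho> \<noteq> r"
    proof
      assume "\<rho> = r"
      then have "q x = w x - C * r - K * r\<^sup>2" unfolding q_def \<rho>_def by simp
      moreover have "C * r \<ge> 0" using C r by simp
      ultimately have "q x \<le> - M" using M[OF x] K by linarith
      also have "\<dots> \<le> q z" using M[of z] r unfolding q_def by auto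
      finally show False using less by simp
    qed
    then have "x \<in> ball z r" using x unfolding \<rho>_def by (auto simp: dist_norm norm_minus_commute)
    then obtain e where e: "e > 0" "ball x e \<subseteq> ball z r"
      by (rule openE[OF open_ball])
    define k where "k = C / (2 * \<rho>) + K"
    \<comment> \<open>The cone is not differentiable at its vertex; by AM-GM the quadratic
      \<open>\<rho> / 2 + |y - z|\<^sup>2 / (2 \<rho>)\<close> touches it from above along \<open>|y - z| = \<rho>\<close>.\<close>
    have amgm: "C * norm (y - z) \<le> C * \<rho> / 2 + C / (2 * \<rho>) * (norm (y - z))\<^sup>2" for y
    proof -
      have "0 \<le> C / (2 * \<rho>) * (norm (y - z) - \<rho>)\<^sup>2" using C \<rho> by simp
      also have "\<dots> = C / (2 * \<rho>) * (norm (y - z))\<^sup>2 + C * \<rho> / 2 - C * norm (y - z)"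
        using \<rho> by (simp add: power2_eq_square field_simps)
      finally show ?thesis by simp
    qed
    have eqx: "C * norm (x - z) = C * \<rho> / 2 + C / (2 * \<rho>) * (norm (x - z))\<^sup>2"
      unfolding \<rho>_def[symmetric] using \<rho> by (simp add: power2_eq_square)
    have "F x ((2 * k) *\<^sub>R (x - z)) \<le> c"
    proof (rule viscosity_subsolutionD[OF sub has_C1_gradient_on_scaled_sq_norm _ e(1)])
      show "x \<in> \<Omega>" using x r by blast
      fix y assume "y \<in> ball x e"
      then have "y \<in> cball z r" using e by (meson ball_subset_cball subsetD)
      then have "q y \<le> q x" by (rule max)
      then show "w y - k * (norm (y - z))\<^sup>2 \<le> w x - k * (norm (x - z))\<^sup>2"
        using amgm[of y] eqx unfolding q_def k_def by (simp add: distrib_right)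
    qed
    then have "norm ((2 * k) *\<^sub>R (x - z)) \<le> C" using C x r by blast
    moreover have "norm ((2 * k) *\<^sub>R (x - z)) = C + 2 * K * \<rho>"
    proof -
      have "k > 0" using \<rho> C K unfolding k_def by (simp add: add_nonneg_pos)
      then have "norm ((2 * k) *\<^sub>R (x - z)) = 2 * k * \<rho>" unfolding \<rho>_def by simp
      also have "\<dots> = C + 2 * K * \<rho>" using \<rho> unfolding k_def by (simp add: field_simps)
      finally show ?thesis .
    qed
    ultimately show False using K \<rho> by (simp add: mult_le_0_iff)
  qed
  then show ?thesis using max[OF y] unfolding q_def by simp
qed

text \<open>Chaining the cone bound over \<open>n\<close> equal steps adds the linear terms to
  \<open>C d\<close> and accumulates \<open>n\<close> errors \<open>K (d / n)^2\<close>, whose sum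
  \<open>K d^2 / n\<close> vanishes in the limit.\<close>

lemma viscosity_subsolution_Lipschitz_segment:
  fixes w :: "'a::euclidean_space \<Rightarrow> real"
  assumes sub: "viscosity_subsolution F c \<Omega> w" and op: "open \<Omega>"
    and C: "C \<ge> 0" "\<And>x p. x \<in> \<Omega> \<Longrightarrow> F x p \<le> c \<Longrightarrow> norm p \<le> C"
    and seg: "closed_segment a b \<subseteq> \<Omega>"
  shows "w b - w a \<le> C * norm (b - a)"
proof -
  have contw: "continuous_on \<Omega> w" using sub unfolding viscosity_subsolution_def by blast
  obtain r where r: "r > 0" and rsub: "(\<Union>x\<in>closed_segment a b. cball x r) \<subseteq> \<Omega>"
    using compact_subset_open_imp_cball_epsilon_subset[OF compact_segment op seg] by blast
  \<comment> \<open>A compact tube around the segment: one bound \<open>M\<close> of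
    \<open>w\<close> on it gives one \<open>K\<close> for all centres, independent of the number of
    steps.\<close>
  define N where "N = {x + y |x y. x \<in> closed_segment a b \<and> y \<in> cball 0 r}"
  have inN: "y \<in> N" if "z \<in> closed_segment a b" "y \<in> cball z r" for y z
  proof -
    have "y = z + (y - z)" "y - z \<in> cball 0 r" using that by (auto simp: dist_norm norm_minus_commute)
    then show ?thesis using that unfolding N_def by blast
  qed
  have "N \<subseteq> \<Omega>" using rsub unfolding N_def by (force simp: dist_norm)
  moreover have "compact N" unfolding N_def by (intro compact_sums compact_segment compact_cball)
  ultimately have "bounded (w ` N)"
    using compact_continuous_image[of N w] contw continuous_on_subset compact_imp_bounded by blast
  then obtain M where M: "\<And>y. y \<in> N \<Longrightarrow> \<bar>w y\<bar> \<le> M" unfolding bounded_iff by auto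
  have "M \<ge> 0" using M[OF inN[of a a]] r by force
  define K where "K = 2 * M / r\<^sup>2 + 1"
  have K: "K > 0" "2 * M \<le> K * r\<^sup>2"
    using r \<open>M \<ge> 0\<close> unfolding K_def by (auto simp: field_simps add_nonneg_pos)
  have step: "w y \<le> w z + C * norm (y - z) + K * (norm (y - z))\<^sup>2"
    if "z \<in> closed_segment a b" "y \<in> cball z r" for y z
    by (rule viscosity_subsolution_cone_bound[OF sub C r(1) _ _ K that(2)])
      (use that rsub M inN in \<open>auto\<close>)
  define d where "d = norm (b - a)"
  have main: "w b - w a \<le> C * d + K * d\<^sup>2 / real n" if n: "n > 0" "d / real n \<le> r" for n
  proof -
    define p where "p i = a + (real i / real n) *\<^sub>R (b - a)" for i
    have diff: "norm (p (Suc i) - p i) = d / real n" for i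
    proof -
      have "p (Suc i) - p i = (1 / real n) *\<^sub>R (b - a)"
        unfolding p_def by (simp add: add_divide_distrib scaleR_left_distrib)
      then show ?thesis unfolding d_def by simp
    qed
    have "w (p i) \<le> w a + real i * (C * (d / real n) + K * (d / real n)\<^sup>2)" if "i \<le> n" for i
      using that
    proof (induction i)
      case 0
      then show ?case unfolding p_def by simp
    next
      case (Suc i)
      have "p i = (1 - real i / real n) *\<^sub>R a + (real i / real n) *\<^sub>R b"
        unfolding p_def by (simp add: algebra_simps)
      moreover have "0 \<le> real i / real n" "real i / real n \<le> 1" using Suc.prems n by auto
      ultimately have "p i \<in> closed_segment a b" unfolding closed_segment_def by blast
      then have "w (p (Suc i)) \<le> w (p i) + C * (d / real n) + K * (d / real n)\<^sup>2"
        using step[of "p i" "p (Suc i)"] n diff[of i]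
        by (simp add: dist_norm norm_minus_commute)
      moreover have "w (p i) \<le> w a + real i * (C * (d / real n) + K * (d / real n)\<^sup>2)"
        using Suc by simp
      moreover have "real (Suc i) * (C * (d / real n) + K * (d / real n)\<^sup>2)
          = real i * (C * (d / real n) + K * (d / real n)\<^sup>2) + C * (d / real n) + K * (d / real n)\<^sup>2"
        by (simp only: of_nat_Suc distrib_right mult_1 add_ac)
      ultimately show ?case by linarith
    qed
    from this[of n] have "w b \<le> w a + real n * (C * (d / real n) + K * (d / real n)\<^sup>2)"
      using n unfolding p_def by simp
    also have "real n * (C * (d / real n) + K * (d / real n)\<^sup>2) = C * d + K * d\<^sup>2 / real n"
      using n by (simp add: power2_eq_square field_simps)
    finally show ?thesis by simp
  qed
  have "(\<lambda>n. C * d + K * d\<^sup>2 / real n) \<longlonglongrightarrow> C * d + 0"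
    by (intro tendsto_intros lim_const_over_n)
  moreover have "\<forall>\<^sub>F n in sequentially. d / real n < r"
    using order_tendstoD(2)[OF lim_const_over_n[of d]] r by simp
  then have "\<forall>\<^sub>F n in sequentially. w b - w a \<le> C * d + K * d\<^sup>2 / real n"
    using eventually_gt_at_top[of 0] by eventually_elim (auto intro: main)
  ultimately show ?thesis unfolding d_def using tendsto_lowerbound by fastforce
qed

section \<open>Star-shaped geometry and estimates up to the boundary\<close>

text \<open>A point \<open>z\<close> of the ball outside \<open>\<Omega>\<close> would have a
  frontier point \<open>u z\<close> on its segment to \<open>0\<close>. Then
  \<open>z / (1 - s)\<close> is an outward dilate of that frontier point, at distance at least
  \<open>\<kappa> s / (1 - s)\<close> from the closure, although it is closer than that to
  \<open>x\<close>.\<close>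

lemma A1_ball_subset:
  fixes \<Omega> :: "'a::euclidean_space set"
  assumes op: "open \<Omega>" and zero: "0 \<in> \<Omega>" and \<kappa>: "\<kappa> > 0"
    and dist: "\<And>s x. s > 0 \<Longrightarrow> x \<in> (\<lambda>y. (1 + s) *\<^sub>R y) ` frontier \<Omega> \<Longrightarrow> infdist x (closure \<Omega>) \<ge> \<kappa> * s"
    and x: "x \<in> closure \<Omega>" and s: "0 < s" "s < 1"
  shows "ball ((1 - s) *\<^sub>R x) (\<kappa> * s) \<subseteq> \<Omega>"
proof
  fix z assume z: "z \<in> ball ((1 - s) *\<^sub>R x) (\<kappa> * s)"
  show "z \<in> \<Omega>"
  proof (rule ccontr)
    assume "z \<notin> \<Omega>"
    then have "closed_segment 0 z \<inter> frontier \<Omega> \<noteq> {}"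
      using zero by (intro connected_Int_frontier connected_segment) auto
    then obtain y where y: "y \<in> closed_segment 0 z" "y \<in> frontier \<Omega>" by blast
    then obtain u where u: "0 \<le> u" "u \<le> 1" "y = u *\<^sub>R z" by (auto simp: in_segment)
    have "u \<noteq> 0" using y u zero op by (auto simp: frontier_def interior_open)
    then have u: "0 < u" "u \<le> 1" "y = u *\<^sub>R z" using u by auto
    \<comment> \<open>Chosen so that \<open>(1 + s') y = z / (1 - s)\<close>; \<open>u <= 1\<close>
      gives \<open>s' >= s / (1 - s)\<close>.\<close>
    define s' where "s' = 1 / (u * (1 - s)) - 1"
    have "1 / (1 - s) \<le> 1 / (u * (1 - s))"
      using u s by (intro divide_left_mono) (auto simp: mult_le_cancel_right2)
    moreover have "1 / (1 - s) - 1 = s / (1 - s)" using s by (simp add: field_simps)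
    ultimately have s': "s / (1 - s) \<le> s'" unfolding s'_def by linarith
    moreover have "s / (1 - s) > 0" using s by simp
    ultimately have "s' > 0" by linarith
    then have "\<kappa> * s' \<le> infdist ((1 + s') *\<^sub>R y) (closure \<Omega>)"
      using dist[of s' "(1 + s') *\<^sub>R y"] y by blast
    also have "(1 + s') *\<^sub>R y = (1 / (1 - s)) *\<^sub>R z" using u s unfolding s'_def by simp
    finally have "\<kappa> * s' \<le> infdist ((1 / (1 - s)) *\<^sub>R z) (closure \<Omega>)" .
    also have "\<dots> \<le> dist ((1 / (1 - s)) *\<^sub>R z) x" using x by (rule infdist_le)
    also have "\<dots> = norm ((1 / (1 - s)) *\<^sub>R (z - (1 - s) *\<^sub>R x))"
      using s by (simp add: dist_norm scaleR_diff_right)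
    also have "\<dots> = norm (z - (1 - s) *\<^sub>R x) / (1 - s)" using s by simp
    also have "\<dots> < \<kappa> * s / (1 - s)"
      using z s by (intro divide_strict_right_mono) (auto simp: dist_norm norm_minus_commute)
    also have "\<dots> \<le> \<kappa> * s'" using s' \<kappa> by (metis mult_le_cancel_left_pos times_divide_eq_right)
    finally show False by simp
  qed
qed

text \<open>Boundary points are moved towards the origin, where they lie in balls contained in \<open>\<Omega>\<close>.\<close>

lemma Lipschitz_on_closure:
  fixes w :: "'a::euclidean_space \<Rightarrow> real"
  assumes contw: "continuous_on (closure \<Omega>) w" and zero: "0 \<in> \<Omega>" and \<kappa>: "\<kappa> > 0"
    and ball: "\<And>x s. x \<in> closure \<Omega> \<Longrightarrow> 0 < s \<Longrightarrow> s < 1 \<Longrightarrow> ball ((1 - s) *\<^sub>R x) (\<kappa> * s) \<subseteq> \<Omega>"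
    and seg: "\<And>a b. closed_segment a b \<subseteq> \<Omega> \<Longrightarrow> w b - w a \<le> C * norm (b - a)" and C: "C \<ge> 0"
    and B: "\<And>x. x \<in> closure \<Omega> \<Longrightarrow> norm x \<le> B" and x: "x \<in> closure \<Omega>" and y: "y \<in> closure \<Omega>"
  shows "w x - w y \<le> C * (1 + 4 * B / \<kappa>) * norm (x - y)"
proof -
  have B0: "B \<ge> 0" using B[of 0] zero closure_subset by force
  have ray: "u *\<^sub>R x \<in> \<Omega>" if "x \<in> closure \<Omega>" "0 \<le> u" "u < 1" for u x
  proof (cases "u = 0")
    case False
    then show ?thesis using ball[of x "1 - u"] that \<kappa> by (auto simp: subset_eq)
  qed (use zero in simp)
  have radial: "\<bar>w x - w ((1 - s) *\<^sub>R x)\<bar> \<le> C * (s * B)"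
    if x: "x \<in> closure \<Omega>" and s: "0 < s" "s \<le> 1" for x s
  proof -
    \<comment> \<open>At a boundary point \<open>w\<close> is known only through continuity, so
      \<open>x\<close> is approached along its ray by points of \<open>\<Omega>\<close>.\<close>
    let ?a = "\<lambda>n. (1 - inverse (real (Suc n)) * s) *\<^sub>R x"
    have bound: "\<bar>w (?a n) - w ((1 - s) *\<^sub>R x)\<bar> \<le> C * (s * B)" for n
    proof -
      define \<tau> where "\<tau> = inverse (real (Suc n))"
      have \<tau>: "0 < \<tau>" "\<tau> \<le> 1" unfolding \<tau>_def by (auto simp: field_simps)
      have sub: "closed_segment ((1 - \<tau> * s) *\<^sub>R x) ((1 - s) *\<^sub>R x) \<subseteq> \<Omega>"
      proof
        fix z assume "z \<in> closed_segment ((1 - \<tau> * s) *\<^sub>R x) ((1 - s) *\<^sub>R x)"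
        then obtain u where u: "0 \<le> u" "u \<le> 1"
          "z = (1 - u) *\<^sub>R (1 - \<tau> * s) *\<^sub>R x + u *\<^sub>R (1 - s) *\<^sub>R x" by (auto simp: in_segment)
        define m where "m = (1 - u) * \<tau> + u"
        have m: "\<tau> \<le> m" "m \<le> 1"
          using u \<tau> mult_left_mono[of \<tau> 1 u] mult_left_mono[of \<tau> 1 "1 - u"]
          unfolding m_def by (auto simp: algebra_simps)
        have "z = (1 - m * s) *\<^sub>R x" unfolding m_def u(3) by (simp add: algebra_simps)
        moreover have "0 < m * s" "m * s \<le> 1" using m \<tau> s by (auto simp: mult_le_one)
        ultimately show "z \<in> \<Omega>" using ray[OF x, of "1 - m * s"] by simp
      qed
      have nd: "norm ((1 - s) *\<^sub>R x - (1 - \<tau> * s) *\<^sub>R x) \<le> s * B"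
      proof -
        have "(1 - s) *\<^sub>R x - (1 - \<tau> * s) *\<^sub>R x = (- ((1 - \<tau>) * s)) *\<^sub>R x"
          by (simp add: algebra_simps)
        then have "norm ((1 - s) *\<^sub>R x - (1 - \<tau> * s) *\<^sub>R x) = (1 - \<tau>) * s * norm x"
          using \<tau> s by (simp add: abs_mult)
        also have "\<dots> \<le> 1 * s * B" using \<tau> s B[OF x] by (intro mult_mono) auto
        finally show ?thesis by simp
      qed
      have "w ((1 - s) *\<^sub>R x) - w ((1 - \<tau> * s) *\<^sub>R x) \<le> C * (s * B)"
        using seg[OF sub] mult_left_mono[OF nd C] by linarith
      moreover have "w ((1 - \<tau> * s) *\<^sub>R x) - w ((1 - s) *\<^sub>R x) \<le> C * (s * B)"
        using seg[of "(1 - s) *\<^sub>R x" "(1 - \<tau> * s) *\<^sub>R x"] sub mult_left_mono[OF nd C]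
        by (simp add: closed_segment_commute norm_minus_commute)
      ultimately show ?thesis unfolding \<tau>_def by linarith
    qed
    have "?a \<longlonglongrightarrow> (1 - 0 * s) *\<^sub>R x" by (intro tendsto_intros LIMSEQ_inverse_real_of_nat)
    moreover have "?a n \<in> closure \<Omega>" for n
    proof -
      have "0 < inverse (real (Suc n)) * s" using s by simp
      moreover have "inverse (real (Suc n)) * s \<le> 1" using s by (intro mult_le_one) (auto simp: field_simps)
      ultimately have "?a n \<in> \<Omega>" using ray[OF x] by simp
      then show ?thesis using closure_subset by blast
    qed
    ultimately have "(\<lambda>n. w (?a n)) \<longlonglongrightarrow> w x"
      using continuous_on_tendsto_compose[OF contw _ x, of ?a] by (simp del: of_nat_Suc)
    then have "(\<lambda>n. \<bar>w (?a n) - w ((1 - s) *\<^sub>R x)\<bar>) \<longlonglongrightarrow> \<bar>w x - w ((1 - s) *\<^sub>R x)\<bar>"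
      by (intro tendsto_intros)
    then show ?thesis by (rule tendsto_upperbound) (use bound in auto)
  qed
  show ?thesis
  proof (cases "x = y")
    case False
    \<comment> \<open>For \<open>s < 1\<close> the radius \<open>\<kappa> s = 2 |x - y|\<close> of
      the ball around \<open>(1 - s) x\<close> exceeds the distance to \<open>(1 - s) y\<close>, so
      the joining segment lies in \<open>\<Omega>\<close>; at \<open>s = 1\<close> both points are
      \<open>0\<close>. The two radial moves cost \<open>2 C s B\<close>, the origin of
      \<open>4 B / \<kappa>\<close>.\<close>
    define s where "s = min 1 (2 * norm (x - y) / \<kappa>)"
    have s: "0 < s" "s \<le> 1" "s \<le> 2 * norm (x - y) / \<kappa>" using False \<kappa> unfolding s_def by auto
    have mid: "w ((1 - s) *\<^sub>R x) - w ((1 - s) *\<^sub>R y) \<le> C * norm (x - y)"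
    proof (cases "s = 1")
      case True
      then show ?thesis using C by simp
    next
      case False
      then have s1: "s < 1" "\<kappa> * s = 2 * norm (x - y)" using s \<kappa> unfolding s_def by (auto simp: min_def)
      have n: "norm ((1 - s) *\<^sub>R x - (1 - s) *\<^sub>R y) \<le> norm (x - y)"
        using s by (simp add: scaleR_diff_right[symmetric] mult_left_le_one_le)
      have "norm (x - y) > 0" using \<open>x \<noteq> y\<close> by simp
      then have "dist ((1 - s) *\<^sub>R x) ((1 - s) *\<^sub>R y) < \<kappa> * s" "0 < \<kappa> * s"
        using n s1 unfolding dist_norm by linarith+
      then have "(1 - s) *\<^sub>R y \<in> ball ((1 - s) *\<^sub>R x) (\<kappa> * s)" "(1 - s) *\<^sub>R x \<in> ball ((1 - s) *\<^sub>R x) (\<kappa> * s)"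
        by simp_all
      then have "closed_segment ((1 - s) *\<^sub>R y) ((1 - s) *\<^sub>R x) \<subseteq> \<Omega>"
        using ball[OF x s(1) s1(1)] closed_segment_subset[OF _ _ convex_ball] by blast
      then show ?thesis using seg mult_left_mono[OF n C] by fastforce
    qed
    have "w x - w y \<le> C * norm (x - y) + 2 * (C * (s * B))"
      using mid radial[OF x s(1,2)] radial[OF y s(1,2)] by linarith
    also have "\<dots> \<le> C * norm (x - y) + 2 * (C * (2 * norm (x - y) / \<kappa> * B))"
      using s C B0 by (intro add_left_mono mult_left_mono mult_right_mono) auto
    finally show ?thesis by (simp add: algebra_simps)
  qed simp
qed

section \<open>Dilation of subsolutions\<close>

text \<open>If \<open>\<phi>\<close> touches \<open>w(\<theta> x) / \<theta>\<close> from above at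
  \<open>x0\<close>, then \<open>\<theta> \<phi>(y / \<theta>)\<close> touches \<open>w\<close> at
  \<open>\<theta> x0\<close> with the same gradient, which is what the factor
  \<open>1 / \<theta>\<close> achieves. The rescaled function is available only on a dilate of
  \<open>\<Omega>\<close>, hence the recourse to a local test.\<close>

lemma viscosity_subsolution_dilation:
  fixes H F :: "'a::euclidean_space \<Rightarrow> 'a \<Rightarrow> real"
  assumes sub: "viscosity_subsolution H c \<Omega> w" and op: "open \<Omega>"
    and contH: "continuous_on (\<Omega> \<times> UNIV) (\<lambda>(x, p). H x p)"
    and \<theta>: "\<theta> > 0" and dil: "\<And>x. x \<in> \<Omega> \<Longrightarrow> \<theta> *\<^sub>R x \<in> \<Omega>"
    and F: "\<And>x p. x \<in> \<Omega> \<Longrightarrow> F x p \<le> H (\<theta> *\<^sub>R x) p - c"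
  shows "viscosity_subsolution F 0 \<Omega> (\<lambda>x. w (\<theta> *\<^sub>R x) / \<theta>)"
  unfolding viscosity_subsolution_def
proof (intro conjI allI impI)
  have "continuous_on \<Omega> w" using sub unfolding viscosity_subsolution_def by blast
  then show "continuous_on \<Omega> (\<lambda>x. w (\<theta> *\<^sub>R x) / \<theta>)"
    using \<theta> dil by (intro continuous_intros continuous_on_compose2[where f = "\<lambda>x. \<theta> *\<^sub>R x"]) auto
  fix \<phi> D x0 assume \<phi>: "has_C1_gradient_on \<phi> D \<Omega>" and x0: "x0 \<in> \<Omega>"
    and "\<exists>r>0. \<forall>y\<in>\<Omega> \<inter> ball x0 r. w (\<theta> *\<^sub>R y) / \<theta> - \<phi> y \<le> w (\<theta> *\<^sub>R x0) / \<theta> - \<phi> x0"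
  then obtain r where r: "r > 0" and max: "\<And>y. y \<in> \<Omega> \<Longrightarrow> y \<in> ball x0 r \<Longrightarrow>
      w (\<theta> *\<^sub>R y) / \<theta> - \<phi> y \<le> w (\<theta> *\<^sub>R x0) / \<theta> - \<phi> x0" by auto
  obtain r1 where r1: "r1 > 0" "ball x0 r1 \<subseteq> \<Omega>" using op x0 by (rule openE)
  define \<delta> where "\<delta> = min r r1"
  have \<delta>: "\<delta> > 0" "ball x0 \<delta> \<subseteq> \<Omega>" "ball x0 \<delta> \<subseteq> ball x0 r"
    using r r1 unfolding \<delta>_def by (auto simp: subset_eq)
  let ?T = "ball (\<theta> *\<^sub>R x0) (\<theta> * \<delta>)"
  have T: "(1 / \<theta>) *\<^sub>R y \<in> ball x0 \<delta>" if "y \<in> ?T" for y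
  proof -
    have "x0 - (1 / \<theta>) *\<^sub>R y = (1 / \<theta>) *\<^sub>R (\<theta> *\<^sub>R x0 - y)"
      using \<theta> by (simp add: scaleR_diff_right)
    then have "dist x0 ((1 / \<theta>) *\<^sub>R y) = dist (\<theta> *\<^sub>R x0) y / \<theta>"
      using \<theta> unfolding dist_norm by simp
    also have "\<dots> < \<delta>" using that \<theta> by (simp add: pos_divide_less_eq mult.commute)
    finally show ?thesis by simp
  qed
  have "H (\<theta> *\<^sub>R x0) (D ((1 / \<theta>) *\<^sub>R \<theta> *\<^sub>R x0)) \<le> c"
  proof (rule viscosity_subsolution_local_test[OF sub op contH,
      where r = "\<theta> * \<delta>" and \<psi> = "\<lambda>y. \<theta> * \<phi> ((1 / \<theta>) *\<^sub>R y)" and D = "\<lambda>y. D ((1 / \<theta>) *\<^sub>R y)"])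
    show "\<theta> *\<^sub>R x0 \<in> \<Omega>" by (rule dil[OF x0])
    show "0 < \<theta> * \<delta>" using \<theta> \<delta> by simp
    show "has_C1_gradient_on (\<lambda>y. \<theta> * \<phi> ((1 / \<theta>) *\<^sub>R y)) (\<lambda>y. D ((1 / \<theta>) *\<^sub>R y)) ?T"
      unfolding has_C1_gradient_on_def
    proof (intro conjI ballI)
      have "continuous_on \<Omega> D" using \<phi> unfolding has_C1_gradient_on_def by blast
      then show "continuous_on ?T (\<lambda>y. D ((1 / \<theta>) *\<^sub>R y))"
        by (rule continuous_on_compose2) (use T \<delta> in \<open>auto intro!: continuous_intros\<close>)
      fix y assume y: "y \<in> ?T"
      then have "(1 / \<theta>) *\<^sub>R y \<in> \<Omega>" using T \<delta> by blast
      then have "(\<phi> has_derivative (\<lambda>h. h \<bullet> D ((1 / \<theta>) *\<^sub>R y))) (at ((1 / \<theta>) *\<^sub>R y))"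
        using \<phi> op unfolding has_C1_gradient_on_def by (metis at_within_open)
      moreover have "((\<lambda>y. (1 / \<theta>) *\<^sub>R y) has_derivative (\<lambda>h. (1 / \<theta>) *\<^sub>R h)) (at y within ?T)"
        by (intro derivative_intros)
      ultimately have "((\<lambda>y. \<phi> ((1 / \<theta>) *\<^sub>R y)) has_derivative
          (\<lambda>h. ((1 / \<theta>) *\<^sub>R h) \<bullet> D ((1 / \<theta>) *\<^sub>R y))) (at y within ?T)"
        by (rule has_derivative_compose[rotated])
      then have "((\<lambda>y. \<theta> * \<phi> ((1 / \<theta>) *\<^sub>R y)) has_derivative
          (\<lambda>h. \<theta> * (((1 / \<theta>) *\<^sub>R h) \<bullet> D ((1 / \<theta>) *\<^sub>R y)))) (at y within ?T)"
        by (rule has_derivative_mult_right)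
      then show "((\<lambda>y. \<theta> * \<phi> ((1 / \<theta>) *\<^sub>R y)) has_derivative (\<lambda>h. h \<bullet> D ((1 / \<theta>) *\<^sub>R y))) (at y within ?T)"
        using \<theta> by simp
    qed
    fix y assume "y \<in> ?T"
    then have "(1 / \<theta>) *\<^sub>R y \<in> ball x0 \<delta>" by (rule T)
    then have "w (\<theta> *\<^sub>R (1 / \<theta>) *\<^sub>R y) / \<theta> - \<phi> ((1 / \<theta>) *\<^sub>R y) \<le> w (\<theta> *\<^sub>R x0) / \<theta> - \<phi> x0"
      using max \<delta> by blast
    from mult_left_mono[OF this less_imp_le[OF \<theta>]]
    show "w y - \<theta> * \<phi> ((1 / \<theta>) *\<^sub>R y) \<le> w (\<theta> *\<^sub>R x0) - \<theta> * \<phi> ((1 / \<theta>) *\<^sub>R \<theta> *\<^sub>R x0)"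
      using \<theta> by (simp add: right_diff_distrib)
  qed
  then show "F x0 (D x0) \<le> 0" using F[OF x0, of "D x0"] \<theta> by simp
qed

section \<open>The Lagrangian and its radial derivative\<close>

lemma lagrangian_upper:
  assumes "H4 H K" "x \<in> K"
  shows "p \<bullet> v - H x p \<le> lagrangian H x v"
  unfolding lagrangian_def using assms unfolding H4_def by (auto intro!: cSUP_upper)

text \<open>Finiteness of \<open>L\<close> at the vectors \<open>\<plusminus> a n e\<^sub>i\<close> bounds \<open>H(x, p)\<close> from below by \<open>a n |p\<^sub>i|\<close>, up to
  a constant; averaging over \<open>i\<close> gives linear growth of rate \<open>a\<close>.\<close>

lemma H4_imp_linear_growth:
  fixes H :: "'a::euclidean_space \<Rightarrow> 'a \<Rightarrow> real"
  assumes H4: "H4 H K" and comp: "compact K" and a: "a \<ge> 0"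
  obtains M where "\<And>x p. x \<in> K \<Longrightarrow> a * norm p \<le> H x p + M"
proof -
  \<comment> \<open>Uniform in \<open>x\<close> because \<open>L(., v)\<close> is continuous on the
    compact set \<open>K\<close>.\<close>
  have "\<exists>m. \<forall>x\<in>K. \<forall>p. p \<bullet> v - H x p \<le> m" for v
  proof -
    obtain D where "has_C1_gradient_on (\<lambda>x. lagrangian H x v) D K" using H4 unfolding H4_def by blast
    then have "compact ((\<lambda>x. lagrangian H x v) ` K)"
      by (intro compact_continuous_image comp has_C1_gradient_on_imp_continuous_on)
    then obtain m where m: "\<forall>y\<in>(\<lambda>x. lagrangian H x v) ` K. norm y \<le> m"
      using compact_imp_bounded bounded_iff by metis
    have "p \<bullet> v - H x p \<le> m" if "x \<in> K" for x p
      using lagrangian_upper[OF H4 that, of p v] m that by fastforce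
    then show ?thesis by blast
  qed
  then obtain m where m: "\<And>v x p. x \<in> K \<Longrightarrow> p \<bullet> v - H x p \<le> m v" by metis
  define n where "n = real DIM('a)"
  have n: "n > 0" unfolding n_def by simp
  define e where "e b = (a * n) *\<^sub>R b" for b :: 'a
  define M where "M = (\<Sum>b\<in>Basis. \<bar>m (e b)\<bar> + \<bar>m (- e b)\<bar>)"
  show ?thesis
  proof (rule that[of M])
    fix x p assume x: "x \<in> K"
    have "a * n * \<bar>p \<bullet> b\<bar> \<le> H x p + M" if b: "b \<in> Basis" for b
    proof -
      have "\<bar>m (e b)\<bar> + \<bar>m (- e b)\<bar> \<le> M"
        unfolding M_def by (rule member_le_sum[OF b]) auto
      moreover have "a * n * (p \<bullet> b) - H x p \<le> m (e b)" "- (a * n * (p \<bullet> b)) - H x p \<le> m (- e b)"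
        using m[OF x, of p "e b"] m[OF x, of p "- e b"] unfolding e_def by simp_all
      moreover have "a * n * \<bar>p \<bullet> b\<bar> = \<bar>a * n * (p \<bullet> b)\<bar>" using a n by (simp add: abs_mult)
      ultimately show ?thesis by linarith
    qed
    then have "(\<Sum>b\<in>Basis. a * n * \<bar>p \<bullet> b\<bar>) \<le> (\<Sum>b\<in>(Basis::'a set). H x p + M)" by (rule sum_mono)
    then have "n * (a * (\<Sum>b\<in>Basis. \<bar>p \<bullet> b\<bar>)) \<le> n * (H x p + M)"
      unfolding n_def by (simp add: sum_distrib_left mult_ac)
    then have "a * (\<Sum>b\<in>Basis. \<bar>p \<bullet> b\<bar>) \<le> H x p + M" using n by simp
    moreover have "a * norm p \<le> a * (\<Sum>b\<in>Basis. \<bar>p \<bullet> b\<bar>)"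
      using a by (intro mult_left_mono norm_le_l1)
    ultimately show "a * norm p \<le> H x p + M" by simp
  qed
qed

text \<open>For \<open>|v| <= h\<close>, growth of rate \<open>h + 1\<close> gives
  \<open>p \<bullet> v - H x p <= M - |p|\<close>. Beyond radius \<open>R\<close> this is below
  \<open>- H y 0\<close>, hence below every \<open>L(y, v')\<close>. So only \<open>|p| <= R\<close>
  competes, with constant \<open>R\<close> in \<open>v\<close> and that of \<open>H1\<close> in
  \<open>x\<close>.\<close>

lemma lagrangian_Lipschitz:
  fixes H :: "'a::euclidean_space \<Rightarrow> 'a \<Rightarrow> real"
  assumes H1: "H1 H K" and H4: "H4 H K" and comp: "compact K"
    and cont: "continuous_on (K \<times> UNIV) (\<lambda>(x, p). H x p)" and h: "h \<ge> 0"
  obtains R C where "R \<ge> 0" "C \<ge> 0"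
    "\<And>x y v v'. x \<in> K \<Longrightarrow> y \<in> K \<Longrightarrow> norm v \<le> h \<Longrightarrow>
      lagrangian H x v \<le> lagrangian H y v' + R * norm (v - v') + C * norm (x - y)"
proof -
  obtain M where M: "\<And>x p. x \<in> K \<Longrightarrow> (h + 1) * norm p \<le> H x p + M"
    using H4_imp_linear_growth[OF H4 comp, of "h + 1"] h by auto
  have "continuous_on K (\<lambda>x. case (x, 0) of (x, p) \<Rightarrow> H x p)"
    by (rule continuous_on_compose2[OF cont]) (auto intro!: continuous_intros)
  then have "compact ((\<lambda>x. H x 0) ` K)" using comp by (simp add: compact_continuous_image)
  then obtain M0 where "\<forall>y\<in>(\<lambda>x. H x 0) ` K. norm y \<le> M0"
    using compact_imp_bounded bounded_iff by metis
  then have M0: "\<bar>H x 0\<bar> \<le> M0" if "x \<in> K" for x using that by simp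
  define R where "R = \<bar>M\<bar> + \<bar>M0\<bar> + 1"
  have "R > 0" unfolding R_def by simp
  then obtain C where C: "\<And>x y p. x \<in> K \<Longrightarrow> y \<in> K \<Longrightarrow> norm p \<le> R \<Longrightarrow>
      \<bar>H x p - H y p\<bar> \<le> C * norm (x - y)"
    using H1 unfolding H1_def by blast
  show ?thesis
  proof (rule that[of R "\<bar>C\<bar>"])
    fix x y v v' :: 'a assume x: "x \<in> K" and y: "y \<in> K" and v: "norm v \<le> h"
    have nn: "0 \<le> R * norm (v - v')" "0 \<le> \<bar>C\<bar> * norm (x - y)" using \<open>R > 0\<close> by simp_all
    have "p \<bullet> v - H x p \<le> lagrangian H y v' + R * norm (v - v') + \<bar>C\<bar> * norm (x - y)" for p
    proof (cases "norm p \<le> R")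
      case True
      have "p \<bullet> (v - v') \<le> norm p * norm (v - v')" by (rule norm_cauchy_schwarz)
      also have "\<dots> \<le> R * norm (v - v')" using True by (intro mult_right_mono) auto
      finally have "p \<bullet> v - p \<bullet> v' \<le> R * norm (v - v')" by (simp add: inner_diff_right)
      moreover have "H y p - H x p \<le> C * norm (x - y)" using C[OF x y True] by linarith
      moreover have "C * norm (x - y) \<le> \<bar>C\<bar> * norm (x - y)" by (intro mult_right_mono) auto
      ultimately show ?thesis using lagrangian_upper[OF H4 y, of p v'] by linarith
    next
      case False
      have "p \<bullet> v \<le> norm p * norm v" by (rule norm_cauchy_schwarz)
      also have "\<dots> \<le> norm p * h" using v by (intro mult_left_mono) auto
      finally have "p \<bullet> v - H x p \<le> M - norm p" using M[OF x, of p] by (simp add: algebra_simps)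
      also have "\<dots> \<le> - H y 0" using False M0[OF y] unfolding R_def by linarith
      also have "\<dots> \<le> lagrangian H y v'" using lagrangian_upper[OF H4 y, of 0 v'] by simp
      finally show ?thesis using nn by linarith
    qed
    then show "lagrangian H x v \<le> lagrangian H y v' + R * norm (v - v') + \<bar>C\<bar> * norm (x - y)"
      unfolding lagrangian_def[of H x v] by (intro cSUP_least) auto
  qed (use \<open>R > 0\<close> in auto)
qed

text \<open>\<open>x\<close> is an interior point, so the gradient is unique and the
  \<open>THE\<close> in \<open>lagrangian_Dx\<close> denotes the one from \<open>H4\<close>; the
  limit is the chain rule along \<open>t \<mapsto> x + t (- x)\<close> at \<open>0\<close>.\<close>

lemma lagrangian_Dx_radial_limit:
  fixes H :: "'a::euclidean_space \<Rightarrow> 'a \<Rightarrow> real"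
  assumes H4: "H4 H (cball 0 R0)" and x: "x \<in> ball 0 R0"
    and s: "filterlim s (at 0) sequentially"
  shows "(\<lambda>n. (lagrangian H ((1 - s n) *\<^sub>R x) v - lagrangian H x v) / s n)
    \<longlonglongrightarrow> (- x) \<bullet> lagrangian_Dx H x v"
proof -
  let ?f = "\<lambda>y. lagrangian H y v"
  obtain D where "has_C1_gradient_on ?f D (cball 0 R0)" using H4 unfolding H4_def by blast
  then have "has_C1_gradient_on ?f D (ball 0 R0)" by (rule has_C1_gradient_on_subset) auto
  then have "(?f has_derivative (\<lambda>y. y \<bullet> D x)) (at x)"
    using x unfolding has_C1_gradient_on_def by (metis at_within_open open_ball)
  then have G: "GDERIV ?f x :> D x" unfolding gderiv_def .
  have "d = D x" if "GDERIV ?f x :> d" for d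
  proof -
    have "(\<lambda>y. y \<bullet> d) = (\<lambda>y. y \<bullet> D x)"
      using has_derivative_unique that G unfolding gderiv_def by blast
    then have "\<forall>y. y \<bullet> d = y \<bullet> D x" by (simp add: fun_eq_iff)
    then show ?thesis by (simp only: vector_eq_ldot)
  qed
  then have Dx: "lagrangian_Dx H x v = D x"
    unfolding lagrangian_Dx_def using G by (rule the_equality[rotated])
  have "((\<lambda>t. x + t *\<^sub>R (- x)) has_derivative (\<lambda>t. t *\<^sub>R (- x))) (at 0)"
    by (auto intro!: derivative_eq_intros)
  moreover have "(?f has_derivative (\<lambda>y. y \<bullet> D x)) (at (x + 0 *\<^sub>R (- x)))"
    using G unfolding gderiv_def by simp
  ultimately have "((\<lambda>t. ?f (x + t *\<^sub>R (- x))) has_derivative (\<lambda>t. (t *\<^sub>R (- x)) \<bullet> D x)) (at 0)"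
    by (rule has_derivative_compose)
  then have "((\<lambda>t. ?f (x + t *\<^sub>R (- x))) has_field_derivative ((- x) \<bullet> D x)) (at 0)"
    unfolding has_field_derivative_def 
    by (rule has_derivative_eq_rhs) (simp add: fun_eq_iff)
  then have "((\<lambda>t. (?f (x + (0 + t) *\<^sub>R (- x)) - ?f (x + 0 *\<^sub>R (- x))) / t) \<longlongrightarrow> (- x) \<bullet> D x) (at 0)"
    unfolding DERIV_def .
  from filterlim_compose[OF this s] show ?thesis
    unfolding Dx by (simp add: algebra_simps)
qed

text \<open>The bound is free of \<open>s\<close>: it is the constant majorant for dominated
  convergence and survives in the limit \<open>s \<rightarrow> 0\<close>.\<close>

lemma lagrangian_radial_quotient_le:
  fixes H :: "'a::euclidean_space \<Rightarrow> 'a \<Rightarrow> real"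
  assumes x: "x \<in> cball 0 R0" and C: "C \<ge> 0" and s: "0 < s" "s < 1"
    and Lip: "\<And>x y. x \<in> cball 0 R0 \<Longrightarrow> y \<in> cball 0 R0 \<Longrightarrow>
      lagrangian H x v \<le> lagrangian H y v + C * norm (x - y)"
  shows "\<bar>(lagrangian H ((1 - s) *\<^sub>R x) v - lagrangian H x v) / s\<bar> \<le> C * R0"
proof -
  have x': "(1 - s) *\<^sub>R x \<in> cball 0 R0"
    using x s mult_left_le_one_le[of "norm x" "1 - s"] by simp
  have "norm (x - (1 - s) *\<^sub>R x) = s * norm x" using s by (simp add: algebra_simps)
  also have "\<dots> \<le> s * R0" using x s by (intro mult_left_mono) auto
  finally have "C * norm (x - (1 - s) *\<^sub>R x) \<le> C * (s * R0)" using C by (rule mult_left_mono)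
  then have "\<bar>lagrangian H ((1 - s) *\<^sub>R x) v - lagrangian H x v\<bar> \<le> C * R0 * s"
    using Lip[OF x x'] Lip[OF x' x]
    by (simp add: norm_minus_commute[of _ x] mult_ac abs_le_iff)
  then show ?thesis using s by (simp add: pos_divide_le_eq)
qed

text \<open>The second \<open>Suc\<close> keeps every step below \<open>1\<close>; with
  \<open>inverse (real (Suc 0)) = 1\<close> the dilation factor \<open>1 - s\<close> would be
  \<open>0\<close>.\<close>

lemma filterlim_inverse_Suc_Suc: "filterlim (\<lambda>n. inverse (real (Suc (Suc n)))) (at 0) sequentially"
  using LIMSEQ_Suc[OF LIMSEQ_inverse_real_of_nat] unfolding filterlim_at
  by (auto simp del: of_nat_Suc)

lemma abs_radial_lagrangian_Dx_le:
  fixes H :: "'a::euclidean_space \<Rightarrow> 'a \<Rightarrow> real"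
  assumes H4: "H4 H (cball 0 R0)" and x: "x \<in> ball 0 R0" and C: "C \<ge> 0"
    and Lip: "\<And>x y. x \<in> cball 0 R0 \<Longrightarrow> y \<in> cball 0 R0 \<Longrightarrow>
      lagrangian H x v \<le> lagrangian H y v + C * norm (x - y)"
  shows "\<bar>(- x) \<bullet> lagrangian_Dx H x v\<bar> \<le> C * R0"
proof (rule tendsto_upperbound[OF tendsto_rabs[OF
      lagrangian_Dx_radial_limit[OF H4 x filterlim_inverse_Suc_Suc]]])
  show "\<forall>\<^sub>F n in sequentially. \<bar>(lagrangian H ((1 - inverse (real (Suc (Suc n)))) *\<^sub>R x) v - lagrangian H x v)
      / inverse (real (Suc (Suc n)))\<bar> \<le> C * R0"
  proof (intro always_eventually allI lagrangian_radial_quotient_le[OF _ C _ _ Lip])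
    show "inverse (real (Suc (Suc n))) < 1" for n by (simp add: field_simps)
  qed (use x in auto)
qed simp

section \<open>Mather measures\<close>

lemma integrable_continuous_on_compact:
  fixes f :: "'b::t2_space \<Rightarrow> real"
  assumes "finite_measure \<mu>" and sets: "sets \<mu> = sets (restrict_space borel S)"
    and comp: "compact S" and cont: "continuous_on S f"
  shows "integrable \<mu> f"
proof -
  interpret finite_measure \<mu> by fact
  have "space \<mu> = S" using sets_eq_imp_space_eq[OF sets] by (simp add: space_restrict_space)
  moreover obtain B where "\<forall>y\<in>f ` S. norm y \<le> B"
    using compact_imp_bounded[OF compact_continuous_image[OF cont comp]] bounded_iff by metis
  ultimately have "AE z in \<mu>. norm (f z) \<le> B" by (intro AE_I2) auto
  moreover have "f \<in> borel_measurable \<mu>"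
    using borel_measurable_continuous_on_restrict[OF cont] measurable_cong_sets[OF sets refl] by blast
  ultimately show ?thesis by (rule integrable_const_bound)
qed

text \<open>A non-integrable function has Bochner integral \<open>0\<close>, so
  \<open>B >= 0\<close> covers that case and no measurability of the radial derivative has to be
  supplied.\<close>

lemma (in prob_space) abs_integral_le:
  fixes f :: "'a \<Rightarrow> real"
  assumes "\<And>z. z \<in> space M \<Longrightarrow> \<bar>f z\<bar> \<le> B" "B \<ge> 0"
  shows "\<bar>\<integral>z. f z \<partial>M\<bar> \<le> B"
proof (cases "integrable M f")
  case True
  have "(\<integral>z. f z \<partial>M) \<le> B" "- B \<le> (\<integral>z. f z \<partial>M)"
    using assms by (intro integral_le_const integral_ge_const AE_I2 True; force)+
  then show ?thesis by linarith
qed (use assms in \<open>simp add: not_integrable_integral_eq\<close>)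

text \<open>\<open>Sup\<close> on the reals is a \<open>LEAST\<close> over the upper bounds; without
  upper bounds the predicate is identically false, hence the same for both sets.\<close>

lemma Sup_not_bdd_above:
  fixes A B :: "real set"
  assumes "\<not> bdd_above A" "\<not> bdd_above B"
  shows "Sup A = Sup B"
proof -
  have "(\<lambda>z. \<forall>x\<in>A. x \<le> z) = (\<lambda>z. \<forall>x\<in>B. x \<le> z)"
    using assms unfolding bdd_above_def by (intro ext iffI; meson)
  then show ?thesis unfolding Sup_real_def by simp
qed

text \<open>If \<open>w\<close> is a subsolution at level \<open>c(0)\<close>, then so is \<open>w((1 - s) x) / (1 - s)\<close> for the
  Lagrangian \<open>L((1 - s) x, v)\<close>. Hence the latter, plus \<open>c(0)\<close>, belongs to \<open>G0\<close>, and its integral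
  against a Mather measure is at least the one at \<open>s = 0\<close>.\<close>

lemma mather_measures_radial_derivative_nonneg:
  fixes H :: "'a::euclidean_space \<Rightarrow> 'a \<Rightarrow> real"
  assumes op: "open \<Omega>" and cl: "closure \<Omega> \<subseteq> ball 0 R0"
    and star: "\<And>x u. x \<in> closure \<Omega> \<Longrightarrow> 0 \<le> u \<Longrightarrow> u < 1 \<Longrightarrow> u *\<^sub>R x \<in> \<Omega>"
    and cont: "continuous_on (cball 0 R0 \<times> UNIV) (\<lambda>(x, p). H x p)"
    and H4: "H4 H (cball 0 R0)" and h: "h > 0"
    and R: "R \<ge> 0" and C: "C \<ge> 0"
    and Lip: "\<And>x y v v'. x \<in> cball 0 R0 \<Longrightarrow> y \<in> cball 0 R0 \<Longrightarrow> norm v \<le> h \<Longrightarrow>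
      lagrangian H x v \<le> lagrangian H y v' + R * norm (v - v') + C * norm (x - y)"
    and w: "continuous_on (closure \<Omega>) w" "viscosity_subsolution H (additive_eigenvalue H \<Omega>) \<Omega> w"
    and \<mu>: "\<mu> \<in> mather_measures H \<Omega> h"
  shows "0 \<le> (\<integral>(x, v). (- x) \<bullet> lagrangian_Dx H x v \<partial>\<mu>)"
proof -
  define c where "c = additive_eigenvalue H \<Omega>"
  let ?S = "closure \<Omega> \<times> cball (0::'a) h"
  have \<Omega>cl: "\<Omega> \<subseteq> closure \<Omega>" by (rule closure_subset)
  have inK: "x \<in> cball 0 R0" if "x \<in> closure \<Omega>" for x using cl that by auto
  have comp: "compact ?S"
  proof (intro compact_Times compact_cball)
    have "bounded (closure \<Omega>)" using cl bounded_ball bounded_subset by blast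
    then show "compact (closure \<Omega>)" using compact_closure bounded_subset[OF _ \<Omega>cl] by blast
  qed
  from \<mu> have sets: "sets \<mu> = sets (restrict_space borel ?S)" and fin: "finite_measure \<mu>"
    and dual: "\<And>f. f \<in> G0 \<Omega> h \<Longrightarrow> 0 \<le> (\<integral>z. f z \<partial>\<mu>)" and prob: "prob_space \<mu>"
    and mean: "(\<integral>(x, v). lagrangian H x v \<partial>\<mu>) = - c"
    unfolding mather_measures_def G0_dual_def c_def by auto
  interpret prob_space \<mu> by (rule prob)
  have sp: "space \<mu> = ?S" using sets_eq_imp_space_eq[OF sets] by (simp add: space_restrict_space)
  have contL: "continuous_on (cball 0 R0 \<times> cball 0 h) (\<lambda>(x, v). lagrangian H x v)"
  proof (rule lipschitz_on_continuous_on, rule lipschitz_onI)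
    fix z z' :: "'a \<times> 'a" assume z: "z \<in> cball 0 R0 \<times> cball 0 h" and z': "z' \<in> cball 0 R0 \<times> cball 0 h"
    obtain x v x' v' where eq: "z = (x, v)" "z' = (x', v')" by (cases z, cases z')
    have "norm (v - v') \<le> dist z z'" "norm (x - x') \<le> dist z z'"
      using dist_snd_le[of z z'] dist_fst_le[of z z'] unfolding eq by (auto simp: dist_norm)
    then have "R * norm (v - v') \<le> R * dist z z'" "C * norm (x - x') \<le> C * dist z z'"
      using R C by (auto intro: mult_left_mono)
    moreover have "lagrangian H x v \<le> lagrangian H x' v' + R * norm (v - v') + C * norm (x - x')"
      "lagrangian H x' v' \<le> lagrangian H x v + R * norm (v - v') + C * norm (x - x')"
      using Lip[of x x' v v'] Lip[of x' x v' v] z z' unfolding eq by (auto simp: norm_minus_commute)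
    ultimately show "dist (case z of (x, v) \<Rightarrow> lagrangian H x v) (case z' of (x, v) \<Rightarrow> lagrangian H x v)
        \<le> (R + C) * dist z z'"
      unfolding eq dist_real_def by (simp add: distrib_right)
  qed (use R C in simp)
  define f where "f \<theta> = (\<lambda>(x, v). lagrangian H (\<theta> *\<^sub>R x) v)" for \<theta>
  have contf: "continuous_on ?S (f \<theta>)" if "0 < \<theta>" "\<theta> \<le> 1" for \<theta>
  proof -
    have "\<theta> *\<^sub>R x \<in> cball 0 R0" if "x \<in> closure \<Omega>" for x
      using inK[OF that] \<open>0 < \<theta>\<close> \<open>\<theta> \<le> 1\<close> mult_left_le_one_le[of "norm x" \<theta>] by auto
    then have "continuous_on ?S (\<lambda>z. case (\<theta> *\<^sub>R fst z, snd z) of (x, v) \<Rightarrow> lagrangian H x v)"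
      by (intro continuous_on_compose2[OF contL] continuous_intros) auto
    then show ?thesis unfolding f_def by (simp add: split_def)
  qed
  have intf: "integrable \<mu> (f \<theta>)" if "0 < \<theta>" "\<theta> \<le> 1" for \<theta>
    by (rule integrable_continuous_on_compact[OF fin sets comp contf[OF that]])
  have dil: "- c \<le> (\<integral>z. f \<theta> z \<partial>\<mu>)" if \<theta>: "0 < \<theta>" "\<theta> < 1" for \<theta>
  proof -
    have \<theta>\<Omega>: "\<theta> *\<^sub>R x \<in> \<Omega>" if "x \<in> closure \<Omega>" for x using star[OF that] \<theta> by simp
    have "(\<lambda>z. f \<theta> z + c) \<in> G0 \<Omega> h"
      unfolding G0_def
    proof (intro CollectI conjI exI)
      show "continuous_on ?S (\<lambda>z. f \<theta> z + c)" using contf \<theta> by (intro continuous_intros) auto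
      show "continuous_on (closure \<Omega>) (\<lambda>x. w (\<theta> *\<^sub>R x) / \<theta>)"
        using \<theta> \<theta>\<Omega> \<Omega>cl by (intro continuous_intros continuous_on_compose2[OF w(1)]) auto
      show "viscosity_subsolution (ham_of h (\<lambda>z. f \<theta> z + c)) 0 \<Omega> (\<lambda>x. w (\<theta> *\<^sub>R x) / \<theta>)"
      proof (rule viscosity_subsolution_dilation[OF w(2) op])
        show "continuous_on (\<Omega> \<times> UNIV) (\<lambda>(x, p). H x p)"
          by (rule continuous_on_subset[OF cont]) (use inK \<Omega>cl in blast)
        fix x p assume "x \<in> \<Omega>"
        then have x: "\<theta> *\<^sub>R x \<in> cball 0 R0" using \<theta>\<Omega> inK \<Omega>cl by blast
        have "p \<bullet> v - (f \<theta> (x, v) + c) \<le> H (\<theta> *\<^sub>R x) p - c" for v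
          using lagrangian_upper[OF H4 x, of p v] unfolding f_def by simp
        then show "ham_of h (\<lambda>z. f \<theta> z + c) x p \<le> H (\<theta> *\<^sub>R x) p - additive_eigenvalue H \<Omega>"
          unfolding ham_of_def c_def[symmetric] using h by (intro cSUP_least) auto
      qed (use \<theta> \<theta>\<Omega> \<Omega>cl in auto)
    qed
    then have "0 \<le> (\<integral>z. f \<theta> z + c \<partial>\<mu>)" by (rule dual)
    also have "\<dots> = (\<integral>z. f \<theta> z \<partial>\<mu>) + c"
      using intf[of \<theta>] \<theta> by (simp add: prob_space)
    finally show ?thesis by simp
  qed
  define s where "s n = inverse (real (Suc (Suc n)))" for n
  have s: "0 < s n" "s n < 1" for n unfolding s_def by (auto simp: field_simps)
  have s0: "filterlim s (at 0) sequentially" unfolding s_def by (rule filterlim_inverse_Suc_Suc)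
  define g where "g n z = (f (1 - s n) z - f 1 z) / s n" for n z
  let ?g = "\<lambda>(x, v). (- x) \<bullet> lagrangian_Dx H x v"
  have lim: "(\<lambda>n. g n z) \<longlonglongrightarrow> ?g z" if "z \<in> space \<mu>" for z
    using lagrangian_Dx_radial_limit[OF H4 _ s0, of "fst z" "snd z"] that cl
    unfolding g_def f_def sp by (auto simp: split_def)
  have intg: "integrable \<mu> (g n)" for n
    unfolding g_def using intf[of 1] intf[of "1 - s n"] s[of n] by (intro Bochner_Integration.integrable_diff integrable_divide_zero) auto
  have bound: "norm (g n z) \<le> C * R0" if "z \<in> space \<mu>" for n z
  proof -
    obtain x v where z: "z = (x, v)" by (cases z)
    then have x: "x \<in> closure \<Omega>" and v: "norm v \<le> h" using that sp by auto
    show ?thesis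
      using lagrangian_radial_quotient_le[OF inK[OF x] C s, of H v n] Lip[OF _ _ v, of _ _ v]
      unfolding g_def f_def z by simp
  qed
  \<comment> \<open>\<open>H4\<close> gives regularity in \<open>x\<close> for each \<open>v\<close>
    separately; joint measurability comes from \<open>?g\<close> being a pointwise limit of
    difference quotients that are jointly continuous.\<close>
  have "?g \<in> borel_measurable \<mu>"
    by (rule borel_measurable_LIMSEQ_real[of \<mu> g]) (use lim intg in auto)
  then have "(\<lambda>n. \<integral>z. g n z \<partial>\<mu>) \<longlonglongrightarrow> (\<integral>z. ?g z \<partial>\<mu>)"
    by (rule integral_dominated_convergence[where w = "\<lambda>_. C * R0"])
      (use lim intg bound in \<open>auto intro!: AE_I2\<close>)
  moreover have "0 \<le> (\<integral>z. g n z \<partial>\<mu>)" for n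
  proof -
    have "(\<integral>z. g n z \<partial>\<mu>) = ((\<integral>z. f (1 - s n) z \<partial>\<mu>) - (\<integral>z. f 1 z \<partial>\<mu>)) / s n"
      unfolding g_def using intf[of 1] intf[of "1 - s n"] s[of n] by simp
    moreover have "(\<integral>z. f 1 z \<partial>\<mu>) = - c" using mean unfolding f_def by simp
    ultimately show ?thesis using dil[of "1 - s n"] s[of n] by simp
  qed
  ultimately show ?thesis using LIMSEQ_le_const by blast
qed

section \<open>Continuity, monotonicity and concavity of the maximal functions\<close>

theorem corollary1p3:
  fixes \<Omega> :: "'a::euclidean_space set" and R0 h :: real and H :: "'a \<Rightarrow> 'a \<Rightarrow> real"
  assumes "open \<Omega>" and "bounded \<Omega>" and "connected \<Omega>" and "0 \<in> \<Omega>"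
    and "(\<lambda>x. 2 *\<^sub>R x) ` \<Omega> \<subseteq> ball 0 R0"
    and "continuous_on (cball 0 R0 \<times> UNIV) (\<lambda>(x, p). H x p)"
    and "H1 H (cball 0 R0)"
    and "H2 H (cball 0 R0)"
    and "H3 H (cball 0 R0)"
    and "H4 H (cball 0 R0)"
    and "A1 \<Omega>"
    and "normalizing_radius H (cball 0 R0) h"
  shows "(\<forall>\<gamma>. continuous_on (closure \<Omega>) (u_gamma H \<Omega> h \<gamma>)) \<and>
    (\<forall>\<alpha> \<beta>. \<alpha> \<le> \<beta> \<longrightarrow>
      (\<forall>x\<in>closure \<Omega>. u_gamma H \<Omega> h \<beta> x \<le> u_gamma H \<Omega> h \<alpha> x) \<and>
      (\<forall>t\<in>{0..1}. \<forall>x\<in>closure \<Omega>.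
         (1 - t) * u_gamma H \<Omega> h \<alpha> x + t * u_gamma H \<Omega> h \<beta> x
           \<le> u_gamma H \<Omega> h ((1 - t) * \<alpha> + t * \<beta>) x))"
proof -
  note op = \<open>open \<Omega>\<close> and zero = \<open>0 \<in> \<Omega>\<close> and H4 = \<open>H4 H (cball 0 R0)\<close>
  let ?E = "E_gamma H \<Omega> h" and ?u = "u_gamma H \<Omega> h" and ?M = "mather_measures H \<Omega> h"
  define c where "c = additive_eigenvalue H \<Omega>"
  define S where "S = {w. continuous_on (closure \<Omega>) w \<and> viscosity_subsolution H c \<Omega> w}"
  define A where "A \<mu> = (\<integral>(x, v). (- x) \<bullet> lagrangian_Dx H x v \<partial>\<mu>)" for \<mu>
  define I where "I w \<mu> = (\<integral>(x, v). w x \<partial>\<mu>)" for w :: "'a \<Rightarrow> real" and \<mu> :: "('a \<times> 'a) measure"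
  have E_iff: "w \<in> ?E \<gamma> \<longleftrightarrow> w \<in> S \<and> (\<forall>\<mu>\<in>?M. \<gamma> * A \<mu> + I w \<mu> \<le> 0)" for w \<gamma>
    unfolding E_gamma_def S_def A_def I_def c_def by auto
  have u_eq: "?u \<gamma> x = (SUP w\<in>?E \<gamma>. w x)" for \<gamma> x by (rule u_gamma_def)
  have S_shift: "(\<lambda>x. w x + a) \<in> S" if "w \<in> S" for w a
    using that unfolding S_def by (auto intro: continuous_intros viscosity_subsolution_add_const)
  have h: "h > 0" using assms(12) unfolding normalizing_radius_def by blast
  have R0: "R0 > 0" using assms(5) zero by force
  have norm\<Omega>: "norm x \<le> R0 / 2" if "x \<in> closure \<Omega>" for x
  proof -
    have "norm y \<le> R0 / 2" if "y \<in> \<Omega>" for y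
    proof -
      have "2 *\<^sub>R y \<in> ball 0 R0" using assms(5) that by blast
      then show ?thesis by simp
    qed
    then have "\<Omega> \<subseteq> cball 0 (R0 / 2)" by auto
    then have "closure \<Omega> \<subseteq> cball 0 (R0 / 2)" by (rule closure_minimal) simp
    then show ?thesis using that by auto
  qed
  have cl: "closure \<Omega> \<subseteq> ball 0 R0" using norm\<Omega> R0 by force
  have \<Omega>K: "\<Omega> \<subseteq> cball 0 R0" using cl closure_subset[of \<Omega>] by force
  obtain \<kappa> where \<kappa>: "\<kappa> > 0" and "\<And>s x. s > 0 \<Longrightarrow> x \<in> (\<lambda>y. (1 + s) *\<^sub>R y) ` frontier \<Omega> \<Longrightarrow>
      infdist x (closure \<Omega>) \<ge> \<kappa> * s"
    using \<open>A1 \<Omega>\<close> unfolding A1_def by blast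
  then have ball: "ball ((1 - s) *\<^sub>R x) (\<kappa> * s) \<subseteq> \<Omega>" if "x \<in> closure \<Omega>" "0 < s" "s < 1" for x s
    using A1_ball_subset[OF op zero] that by blast
  have star: "t *\<^sub>R x \<in> \<Omega>" if "x \<in> closure \<Omega>" "0 \<le> t" "t < 1" for x t
  proof (cases "t = 0")
    case False
    then show ?thesis using ball[of x "1 - t"] that \<kappa> by (auto simp: subset_eq)
  qed (use zero in simp)
  \<comment> \<open>Growth of rate \<open>1\<close> turns \<open>H x p <= c\<close> into
    \<open>norm p <= c + M\<close>; the absolute value in \<open>C\<close> keeps the bound
    nonnegative even if no such \<open>p\<close> exists.\<close>
  obtain M where M: "\<And>x p. x \<in> cball 0 R0 \<Longrightarrow> 1 * norm p \<le> H x p + M"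
    using H4_imp_linear_growth[OF H4 compact_cball, of 1] by auto
  define C where "C = \<bar>c + M\<bar>"
  have C: "C \<ge> 0" "\<And>x p. x \<in> \<Omega> \<Longrightarrow> H x p \<le> c \<Longrightarrow> norm p \<le> C"
    using M \<Omega>K unfolding C_def by (auto, smt (verit) mem_cball_0 subset_iff)
  define K where "K = C * (1 + 4 * (R0 / 2) / \<kappa>)"
  have K0: "K \<ge> 0" unfolding K_def using C(1) R0 \<kappa> by simp
  have Lip: "w x - w y \<le> K * norm (x - y)" if "w \<in> S" "x \<in> closure \<Omega>" "y \<in> closure \<Omega>" for w x y
    unfolding K_def
    by (rule Lipschitz_on_closure[OF _ zero \<kappa> ball _ C(1) norm\<Omega>])
      (use that viscosity_subsolution_Lipschitz_segment[OF _ op C] in \<open>auto simp: S_def\<close>)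
  have S_convex: "(\<lambda>x. (1 - t) * w x + t * w' x) \<in> S" if "w \<in> S" "w' \<in> S" "t \<in> {0..1}" for w w' t
    using that viscosity_subsolution_convex_combination[OF _ _ that(3) op \<Omega>K assms(7,9) C(2)]
    unfolding S_def by (auto intro!: continuous_intros)
  show ?thesis
  proof (cases "S = {} \<or> ?M = {}")
    case True
    \<comment> \<open>Junk values: the supremum of an empty or unbounded set of reals is one fixed number.\<close>
    have const: "?u \<gamma> x = ?u 0 0" for \<gamma> x
    proof (cases "S = {}")
      case True
      then have "?E \<gamma> = {}" for \<gamma> using E_iff by blast
      then show ?thesis unfolding u_eq by simp
    next
      case False
      then obtain w where w: "w \<in> S" by blast
      \<comment> \<open>Without Mather measures the constraint is vacuous, and \<open>S\<close> is
        stable under adding constants.\<close>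
      have E_eq: "?E \<gamma> = S" for \<gamma> using True False E_iff by blast
      have "\<not> bdd_above ((\<lambda>w. w x) ` S)" for x
      proof
        assume "bdd_above ((\<lambda>w. w x) ` S)"
        then obtain B where "\<And>w. w \<in> S \<Longrightarrow> w x \<le> B" unfolding bdd_above_def by blast
        from this[OF S_shift[OF w, of "B - w x + 1"]] show False by simp
      qed
      then show ?thesis unfolding u_eq E_eq by (intro Sup_not_bdd_above)
    qed
    have "continuous_on (closure \<Omega>) (?u \<gamma>)" for \<gamma>
      using continuous_on_const[of "closure \<Omega>" "?u 0 0"] const by (metis (mono_tags) continuous_on_cong)
    moreover have "(1 - t) * ?u \<alpha> x + t * ?u \<beta> x \<le> ?u ((1 - t) * \<alpha> + t * \<beta>) x" for t \<alpha> \<beta> x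
      unfolding const[of \<alpha>] const[of \<beta>] const[of "(1 - t) * \<alpha> + t * \<beta>"] by (simp add: algebra_simps)
    moreover have "?u \<beta> x \<le> ?u \<alpha> x" for \<alpha> \<beta> x
      unfolding const[of \<alpha>] const[of \<beta>] by simp
    ultimately show ?thesis by blast
  next
    case False
    then obtain w0 \<mu>0 where w0: "w0 \<in> S" and \<mu>0: "\<mu>0 \<in> ?M" by blast
    obtain RL CL where RL: "RL \<ge> 0" and CL: "CL \<ge> 0"
      and LipL: "\<And>x y v v'. x \<in> cball 0 R0 \<Longrightarrow> y \<in> cball 0 R0 \<Longrightarrow> norm v \<le> h \<Longrightarrow>
        lagrangian H x v \<le> lagrangian H y v' + RL * norm (v - v') + CL * norm (x - y)"
      using lagrangian_Lipschitz[OF assms(7) H4 compact_cball assms(6), of h] h by (metis less_imp_le)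
    have sets\<mu>: "sets \<mu> = sets (restrict_space borel (closure \<Omega> \<times> cball 0 h))"
      and prob\<mu>: "prob_space \<mu>" and fin\<mu>: "finite_measure \<mu>" if "\<mu> \<in> ?M" for \<mu>
      using that unfolding mather_measures_def G0_dual_def by auto
    have sp\<mu>: "space \<mu> = closure \<Omega> \<times> cball 0 h" if "\<mu> \<in> ?M" for \<mu>
      using sets_eq_imp_space_eq[OF sets\<mu>[OF that]] by (simp add: space_restrict_space)
    have comp: "compact (closure \<Omega> \<times> cball (0::'a) h)"
      using \<open>bounded \<Omega>\<close> by (intro compact_Times compact_cball) (simp add: compact_closure)
    have int: "integrable \<mu> (\<lambda>(x, v). w x)" if "\<mu> \<in> ?M" "w \<in> S" for \<mu> w
    proof (rule integrable_continuous_on_compact[OF fin\<mu> sets\<mu> comp])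
      have "continuous_on (closure \<Omega>) w" using that unfolding S_def by blast
      then have "continuous_on (closure \<Omega> \<times> cball 0 h) (\<lambda>z. w (fst z))"
        by (rule continuous_on_compose2) (auto intro: continuous_intros)
      then show "continuous_on (closure \<Omega> \<times> cball 0 h) (\<lambda>(x, v). w x)" by (simp add: split_def)
    qed (use that in auto)
    have I_comb: "I (\<lambda>x. (1 - t) * w x + t * w' x) \<mu> = (1 - t) * I w \<mu> + t * I w' \<mu>"
      if "\<mu> \<in> ?M" "w \<in> S" "w' \<in> S" for t w w' \<mu>
      using int[OF that(1,2)] int[OF that(1,3)] unfolding I_def by (simp add: split_def)
    have I_le: "I w \<mu> \<le> B" if "\<mu> \<in> ?M" "w \<in> S" "\<And>x. x \<in> closure \<Omega> \<Longrightarrow> w x \<le> B" for \<mu> w B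
    proof -
      interpret prob_space \<mu> by (rule prob\<mu>[OF that(1)])
      show ?thesis unfolding I_def
        by (rule integral_le_const[OF int[OF that(1,2)]]) (use that(3) sp\<mu>[OF that(1)] in \<open>auto intro!: AE_I2\<close>)
    qed
    have I_ge: "B \<le> I w \<mu>" if "\<mu> \<in> ?M" "w \<in> S" "\<And>x. x \<in> closure \<Omega> \<Longrightarrow> B \<le> w x" for \<mu> w B
    proof -
      interpret prob_space \<mu> by (rule prob\<mu>[OF that(1)])
      show ?thesis unfolding I_def
        by (rule integral_ge_const[OF int[OF that(1,2)]]) (use that(3) sp\<mu>[OF that(1)] in \<open>auto intro!: AE_I2\<close>)
    qed
    have A_nonneg: "0 \<le> A \<mu>" if "\<mu> \<in> ?M" for \<mu>
      unfolding A_def using w0 unfolding S_def c_def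
      by (intro mather_measures_radial_derivative_nonneg[OF op cl star assms(6) H4 h RL CL LipL _ _ that]) auto
    have A_le: "\<bar>A \<mu>\<bar> \<le> CL * R0" if \<mu>: "\<mu> \<in> ?M" for \<mu>
      unfolding A_def
    proof (rule prob_space.abs_integral_le[OF prob\<mu>[OF \<mu>]])
      fix z assume "z \<in> space \<mu>"
      then obtain x v where z: "z = (x, v)" and x: "x \<in> closure \<Omega>" and v: "norm v \<le> h"
        using sp\<mu>[OF \<mu>] by auto
      have "\<bar>(- x) \<bullet> lagrangian_Dx H x v\<bar> \<le> CL * R0"
        by (rule abs_radial_lagrangian_Dx_le[OF H4 _ CL]) (use x cl LipL[OF _ _ v, of _ _ v] in auto)
      then show "\<bar>case z of (x, v) \<Rightarrow> (- x) \<bullet> lagrangian_Dx H x v\<bar> \<le> CL * R0" unfolding z by simp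
    qed (use CL R0 in simp)
    \<comment> \<open>The constraint at \<open>\<mu>0\<close> bounds the mean of \<open>w\<close>.
      Points of the closure are at most \<open>R0\<close> apart, as \<open>2 \<Omega>\<close> lies
      in the ball of radius \<open>R0\<close>, so \<open>w\<close> exceeds its mean by at most
      \<open>K * R0\<close>.\<close>
    have bound: "w x \<le> - \<gamma> * A \<mu>0 + K * R0" if w: "w \<in> ?E \<gamma>" and x: "x \<in> closure \<Omega>" for w \<gamma> x
    proof -
      have wS: "w \<in> S" using w E_iff by blast
      have "w x - K * R0 \<le> w y" if y: "y \<in> closure \<Omega>" for y
      proof -
        have "norm (x - y) \<le> R0"
          using norm_triangle_ineq4[of x y] norm\<Omega>[OF x] norm\<Omega>[OF y] by linarith
        then have "K * norm (x - y) \<le> K * R0" using K0 by (rule mult_left_mono)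
        then show ?thesis using Lip[OF wS x y] by linarith
      qed
      then have "w x - K * R0 \<le> I w \<mu>0" using I_ge[OF \<mu>0 wS] by blast
      moreover have "\<gamma> * A \<mu>0 + I w \<mu>0 \<le> 0" using w E_iff \<mu>0 by blast
      ultimately show ?thesis by linarith
    qed
    have bdd: "bdd_above ((\<lambda>w. w x) ` ?E \<gamma>)" if "x \<in> closure \<Omega>" for x \<gamma>
      using bound[OF _ that] by (intro bdd_aboveI2) auto
    have upper: "w x \<le> ?u \<gamma> x" if "w \<in> ?E \<gamma>" "x \<in> closure \<Omega>" for w \<gamma> x
      unfolding u_eq by (rule cSUP_upper[OF that(1) bdd[OF that(2)]])
    have nonempty: "?E \<gamma> \<noteq> {}" for \<gamma>
    proof -
      \<comment> \<open>\<open>w0 - a\<close> is at most \<open>- |\<gamma>| * CL * R0\<close> on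
        the closure, and \<open>CL * R0\<close> bounds \<open>|A \<mu>|\<close> for all Mather
        measures at once, so one shift meets every constraint.\<close>
      define a where "a = w0 0 + K * R0 + \<bar>\<gamma>\<bar> * (CL * R0)"
      have w0_le: "w0 x \<le> w0 0 + K * R0" if x: "x \<in> closure \<Omega>" for x
      proof -
        have "norm (x - 0) \<le> R0" using norm\<Omega>[OF x] R0 by simp
        then have "K * norm (x - 0) \<le> K * R0" using K0 by (rule mult_left_mono)
        moreover have "0 \<in> closure \<Omega>" using zero closure_subset by blast
        ultimately show ?thesis using Lip[OF w0 x] by force
      qed
      have "(\<lambda>x. w0 x + (- a)) \<in> ?E \<gamma>"
        unfolding E_iff
      proof (intro conjI ballI)
        fix \<mu> assume \<mu>: "\<mu> \<in> ?M"
        have "I (\<lambda>x. w0 x + (- a)) \<mu> \<le> - (\<bar>\<gamma>\<bar> * (CL * R0))"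
          by (rule I_le[OF \<mu> S_shift[OF w0]]) (use w0_le in \<open>force simp: a_def\<close>)
        moreover have "\<gamma> * A \<mu> \<le> \<bar>\<gamma>\<bar> * (CL * R0)"
          using mult_left_mono[OF A_le[OF \<mu>], of "\<bar>\<gamma>\<bar>"] abs_ge_self[of "\<gamma> * A \<mu>"]
          by (simp add: abs_mult)
        ultimately show "\<gamma> * A \<mu> + I (\<lambda>x. w0 x + (- a)) \<mu> \<le> 0" by linarith
      qed (rule S_shift[OF w0])
      then show ?thesis by blast
    qed
    have least: "?u \<gamma> x \<le> B" if "\<And>w. w \<in> ?E \<gamma> \<Longrightarrow> w x \<le> B" for \<gamma> x B
      unfolding u_eq by (rule cSUP_least[OF nonempty that])
    have LipU: "?u \<gamma> x \<le> ?u \<gamma> y + K * norm (x - y)" if "x \<in> closure \<Omega>" "y \<in> closure \<Omega>" for \<gamma> x y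
    proof (rule least)
      fix w assume w: "w \<in> ?E \<gamma>"
      then have "w \<in> S" using E_iff by blast
      then show "w x \<le> ?u \<gamma> y + K * norm (x - y)" using Lip[of w x y] upper[OF w that(2)] that by linarith
    qed
    have "continuous_on (closure \<Omega>) (?u \<gamma>)" for \<gamma>
    proof (rule lipschitz_on_continuous_on[OF lipschitz_onI])
      fix x y assume "x \<in> closure \<Omega>" "y \<in> closure \<Omega>"
      then show "dist (?u \<gamma> x) (?u \<gamma> y) \<le> K * dist x y"
        using LipU[of x y \<gamma>] LipU[of y x \<gamma>] by (simp add: dist_norm norm_minus_commute abs_le_iff)
    qed (rule K0)
    \<comment> \<open>Since \<open>A \<mu> >= 0\<close>, lowering the parameter weakens the
      constraint, so \<open>?E \<beta>\<close> is contained in \<open>?E \<alpha>\<close>.\<close>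
    moreover have "?u \<beta> x \<le> ?u \<alpha> x" if "\<alpha> \<le> \<beta>" "x \<in> closure \<Omega>" for \<alpha> \<beta> x
    proof (rule least)
      fix w assume w: "w \<in> ?E \<beta>"
      have "\<alpha> * A \<mu> + I w \<mu> \<le> 0" if "\<mu> \<in> ?M" for \<mu>
      proof -
        have "\<alpha> * A \<mu> \<le> \<beta> * A \<mu>" using \<open>\<alpha> \<le> \<beta>\<close> A_nonneg[OF that] by (rule mult_right_mono)
        moreover have "\<beta> * A \<mu> + I w \<mu> \<le> 0" using w that E_iff by blast
        ultimately show ?thesis by linarith
      qed
      then have "w \<in> ?E \<alpha>" using w E_iff by blast
      then show "w x \<le> ?u \<alpha> x" using that(2) by (rule upper)
    qed
    moreover have "(1 - t) * ?u \<alpha> x + t * ?u \<beta> x \<le> ?u ((1 - t) * \<alpha> + t * \<beta>) x"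
      if t: "t \<in> {0..1}" and x: "x \<in> closure \<Omega>" for t \<alpha> \<beta> x
    proof -
      let ?U = "?u ((1 - t) * \<alpha> + t * \<beta>) x"
      have comb: "(1 - t) * w x + t * w' x \<le> ?U" if w: "w \<in> ?E \<alpha>" and w': "w' \<in> ?E \<beta>" for w w'
      proof -
        have wS: "w \<in> S" "w' \<in> S" using w w' E_iff by blast+
        have "(\<lambda>x. (1 - t) * w x + t * w' x) \<in> ?E ((1 - t) * \<alpha> + t * \<beta>)"
          unfolding E_iff
        proof (intro conjI ballI)
          show "(\<lambda>x. (1 - t) * w x + t * w' x) \<in> S" using wS t by (rule S_convex)
          fix \<mu> assume \<mu>: "\<mu> \<in> ?M"
          have "(1 - t) * (\<alpha> * A \<mu> + I w \<mu>) \<le> 0" "t * (\<beta> * A \<mu> + I w' \<mu>) \<le> 0"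
            using w w' \<mu> t E_iff by (auto intro!: mult_nonneg_nonpos)
          then show "((1 - t) * \<alpha> + t * \<beta>) * A \<mu> + I (\<lambda>x. (1 - t) * w x + t * w' x) \<mu> \<le> 0"
            unfolding I_comb[OF \<mu> wS] by (simp add: algebra_simps)
        qed
        then show ?thesis using upper[OF _ x] by blast
      qed
      \<comment> \<open>The suprema over \<open>w\<close> and \<open>w'\<close> are taken one at a
        time, which divides by \<open>t\<close> and \<open>1 - t\<close>; the end points are
        therefore separate.\<close>
      show ?thesis
      proof (cases "t = 0 \<or> t = 1")
        case False
        then have t: "0 < t" "t < 1" using t by auto
        have "?u \<alpha> x \<le> (?U - t * ?u \<beta> x) / (1 - t)"
        proof (rule least)
          fix w assume w: "w \<in> ?E \<alpha>"
          have "?u \<beta> x \<le> (?U - (1 - t) * w x) / t"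
            by (rule least) (use comb[OF w] t in \<open>simp add: pos_le_divide_eq algebra_simps\<close>)
          then show "w x \<le> (?U - t * ?u \<beta> x) / (1 - t)"
            using t by (simp add: pos_le_divide_eq algebra_simps)
        qed
        then show ?thesis using t by (simp add: pos_le_divide_eq algebra_simps)
      qed auto
    qed
    ultimately show ?thesis by blast
  qed
qed

end
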